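(* If the group $X$ is linearly ordered and $X=X^i$, then $G$ is isomorphic to the one-dimensional torus $\mathbb T$.
   Context: $G$ is a nontrivial connected compact abelian group; $X$ is its (discrete) character group, written multiplicatively, with unit character $\mathbf 1$. $T\subset X$ is a fixed subsemigroup (positive cone) with $\mathbf 1\in T$, $T\cap T^{-1}=\{\mathbf 1\}$, $X=T^{-1}T$; it defines an order on $X$ by $\xi\le\chi$ iff $\chi\xi^{-1}\in T$. $X$ is linearly ordered means $T\cup T^{-1}=X$. $X^i$ is the set of characters having an index, i.e. the set of $\chi\in X$ of the form $\chi=\chi_1\chi_2^{-1}$ with $\chi_j\in T$ and both sets $T\setminus\chi_jT$ finite ($j=1,2$). $\mathbb T$ is the unit circle group. *)

theory Defs
  imports "HOL-Analysis.Analysis" "HOL-Algebra.Coset"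
begin

text \<open>
  A topological abelian group is a type \<open>'g\<close> of class \<open>topological_ab_group_add\<close>, so the group
  operation of \<open>'g\<close> itself is written \<open>+\<close>.  The circle group is the set \<open>sphere (0::complex) 1\<close>
  under multiplication.  The character group carries the discrete topology, hence is an
  abstract group; it is written multiplicatively.
\<close>

definition character :: "('g::topological_ab_group_add \<Rightarrow> complex) \<Rightarrow> bool" where
  "character \<xi> \<longleftrightarrow>
     continuous_on UNIV \<xi> \<and> range \<xi> \<subseteq> sphere 0 1 \<and> (\<forall>x y. \<xi> (x + y) = \<xi> x * \<xi> y)"

definition character_group :: "('g::topological_ab_group_add \<Rightarrow> complex) monoid" where
  "character_group =
     \<lparr>carrier = {\<xi>. character \<xi>}, mult = (\<lambda>\<xi> \<psi> x. \<xi> x * \<psi> x), one = (\<lambda>x. 1)\<rparr>"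

lemma comm_group_character_group:
  "comm_group (character_group :: ('g::topological_ab_group_add \<Rightarrow> complex) monoid)"
proof (rule comm_groupI)
  fix \<xi> :: "'g \<Rightarrow> complex"
  assume "\<xi> \<in> carrier character_group"
  then have \<xi>: "character \<xi>"
    by (simp add: character_group_def)
  then have norm: "norm (\<xi> x) = 1" for x
    by (auto simp: character_def image_subset_iff)
  then have nz: "\<xi> x \<noteq> 0" for x
    by (metis norm_zero zero_neq_one)
  have "character (\<lambda>x. inverse (\<xi> x))"
    using \<xi> norm nz by (auto simp: character_def image_subset_iff norm_inverse intro!: continuous_on_inverse)
  then show "\<exists>\<psi>\<in>carrier character_group. \<psi> \<otimes>\<^bsub>character_group\<^esub> \<xi> = \<one>\<^bsub>character_group\<^esub>"
    using nz by (intro bexI[of _ "\<lambda>x. inverse (\<xi> x)"]) (auto simp: character_group_def)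
qed (auto simp: character_group_def character_def image_subset_iff norm_mult mult_ac
       intro!: continuous_on_mult)

definition positive_cone :: "'a set \<Rightarrow> ('a, 'b) monoid_scheme \<Rightarrow> bool" where
  "positive_cone T X \<longleftrightarrow>
     submonoid T X \<and> T \<inter> set_inv\<^bsub>X\<^esub> T = {\<one>\<^bsub>X\<^esub>} \<and> carrier X = set_inv\<^bsub>X\<^esub> T <#>\<^bsub>X\<^esub> T"

definition linearly_ordered_by :: "('a, 'b) monoid_scheme \<Rightarrow> 'a set \<Rightarrow> bool" where
  "linearly_ordered_by X T \<longleftrightarrow> T \<union> set_inv\<^bsub>X\<^esub> T = carrier X"

definition elements_with_index :: "('a, 'b) monoid_scheme \<Rightarrow> 'a set \<Rightarrow> 'a set" where
  "elements_with_index X T =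
     {\<xi> \<in> carrier X. \<exists>\<xi>\<^sub>1\<in>T. \<exists>\<xi>\<^sub>2\<in>T.
        \<xi> = \<xi>\<^sub>1 \<otimes>\<^bsub>X\<^esub> inv\<^bsub>X\<^esub> \<xi>\<^sub>2 \<and>
        finite (T - (\<xi>\<^sub>1 <#\<^bsub>X\<^esub> T)) \<and> finite (T - (\<xi>\<^sub>2 <#\<^bsub>X\<^esub> T))}"

end

theory Submission
  imports Defs "HOL-Complex_Analysis.Great_Picard"
begin

text \<open>
  The order hypotheses make the character group cyclic. Every initial segment of the positive cone is
  finite, so the cone has a least element \<open>\<xi>\<close> above the unit, and every element of the cone is a power of
  it (\<open>positive_cone_cyclic\<close>). As the order is linear, every character or its inverse is a power of \<open>\<xi>\<close>.
  A point at which \<open>\<xi>\<close> takes the value 1 is therefore a point at which all characters take the value 1.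
  Since the characters of a compact abelian group separate points, \<open>\<xi>\<close> is injective. Its range is the
  whole circle because the group is connected and nontrivial (\<open>range_connected_character\<close>), and a
  continuous bijection from a compact space to a Hausdorff space is a homeomorphism.

  The main work is the separation of points (\<open>characters_separate_points\<close>), for which the invariant
  integral is built along the way. The averages of the translates of a continuous function come
  uniformly close to a constant, the mean of the function (\<open>has_mean_exists\<close>). Averages commute, so
  the mean is well defined, linear and translation invariant; it is also strictly positive and
  satisfies Fubini's theorem.

  Given \<open>a \<noteq> 0\<close>, convolution with a suitable even kernel \<open>K\<close> is a nonzero compact self-adjoint operator
  that annihilates every function of period \<open>a\<close>. Its square has a positive eigenvalue \<open>s\<close>
  (\<open>convolve_square_eigenfunction_exists\<close>), and the autocorrelation of an eigenfunction is a
  positive-definite eigenfunction. Among the positive-definite eigenfunctions to \<open>s\<close> that take the value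
  1 at 0 there is one with the largest mean square (\<open>pd_eigenfunctions_maximiser\<close>). These functions form
  a compact convex set, and strict convexity of the mean square makes the maximiser an extreme point.
  An extreme point is multiplicative (\<open>pd_eigenfunctions_maximiser_multiplicative\<close>), hence it is a
  character. It does not have period \<open>a\<close>, because its eigenvalue is not 0.
\<close>

section \<open>Averages of translates\<close>

text \<open>
  The translates are collected in a list, so that a translate may be counted several times: only then
  is an average of averages again an average.
\<close>

definition translate_average :: "'g list \<Rightarrow> ('g::ab_group_add \<Rightarrow> real) \<Rightarrow> 'g \<Rightarrow> real" where
  "translate_average as f x = (\<Sum>a\<leftarrow>as. f (x + a)) / length as"

lemma sum_list_bounds:
  fixes f g :: "'a \<Rightarrow> real"
  shows "(\<And>x. x \<in> set xs \<Longrightarrow> f x \<le> g x) \<Longrightarrow> (\<Sum>x\<leftarrow>xs. f x) \<le> (\<Sum>x\<leftarrow>xs. g x)"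
  by (induction xs) (auto intro: add_mono)

lemma translate_average_le:
  assumes "as \<noteq> []" "\<And>x. f x \<le> c"
  shows "translate_average as f x \<le> c"
proof -
  have "(\<Sum>a\<leftarrow>as. f (x + a)) \<le> (\<Sum>a\<leftarrow>as. c)" using assms by (intro sum_list_bounds)
  also have "\<dots> = length as * c" by (simp add: sum_list_triv)
  finally show ?thesis using assms(1) by (simp add: translate_average_def field_simps)
qed

lemma translate_average_cmult:
  "translate_average as (\<lambda>x. c * f x) x = c * translate_average as f x"
  by (simp add: translate_average_def sum_list_const_mult)

lemma translate_average_uminus:
  "translate_average as (\<lambda>x. - f x) = (\<lambda>x. - translate_average as f x)"
  using translate_average_cmult[of as "-1" f] by auto

lemma translate_average_ge:
  assumes "as \<noteq> []" "\<And>x. c \<le> f x"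
  shows "c \<le> translate_average as f x"
  using translate_average_le[of as "\<lambda>x. - f x" "- c" x] assms
  by (simp add: translate_average_uminus)

lemma translate_average_abs_le:
  assumes "as \<noteq> []" "\<And>x. \<bar>f x\<bar> \<le> c"
  shows "\<bar>translate_average as f x\<bar> \<le> c"
  using translate_average_le[of as f c x] translate_average_ge[of as "-c" f x] assms
  by (simp add: abs_le_iff minus_le_iff)

lemma translate_average_add:
  "translate_average as (\<lambda>x. f x + g x) x = translate_average as f x + translate_average as g x"
  by (simp add: translate_average_def sum_list_addf add_divide_distrib)

lemma translate_average_const: "as \<noteq> [] \<Longrightarrow> translate_average as (\<lambda>x. c) x = c"
  by (simp add: translate_average_def sum_list_triv)

lemma translate_average_minus_const:
  "as \<noteq> [] \<Longrightarrow> translate_average as (\<lambda>x. f x - c) x = translate_average as f x - c"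
  using translate_average_add[of as f "\<lambda>x. - c" x] by (simp add: translate_average_const)

lemma translate_average_shift:
  "translate_average as (\<lambda>x. f (x + b)) x = translate_average as f (x + b)"
  by (simp add: translate_average_def algebra_simps)

lemma translate_average_commute:
  "translate_average as (translate_average bs f) = translate_average bs (translate_average as f)"
proof
  fix x
  have "(\<Sum>a\<leftarrow>as. \<Sum>b\<leftarrow>bs. f (x + a + b)) = (\<Sum>b\<leftarrow>bs. \<Sum>a\<leftarrow>as. f (x + a + b))"
    by (induction as) (auto simp: sum_list_addf)
  then have "(\<Sum>a\<leftarrow>as. \<Sum>b\<leftarrow>bs. f (x + a + b)) = (\<Sum>b\<leftarrow>bs. \<Sum>a\<leftarrow>as. f (x + b + a))"
    by (simp add: algebra_simps)
  then show "translate_average as (translate_average bs f) x = translate_average bs (translate_average as f) x"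
    by (simp add: translate_average_def divide_inverse sum_list_mult_const sum_list_const_mult mult_ac)
qed

lemma translate_average_compose:
  "translate_average as (translate_average bs f) = translate_average [a + b. a \<leftarrow> as, b \<leftarrow> bs] f"
proof
  fix x
  have "(\<Sum>c\<leftarrow>[a + b. a \<leftarrow> as, b \<leftarrow> bs]. f (x + c)) = (\<Sum>a\<leftarrow>as. \<Sum>b\<leftarrow>bs. f (x + a + b))"
    by (induction as) (auto simp: o_def algebra_simps)
  moreover have "length [a + b. a \<leftarrow> as, b \<leftarrow> bs] = length as * length bs"
    by (induction as) auto
  ultimately show "translate_average as (translate_average bs f) x = translate_average [a + b. a \<leftarrow> as, b \<leftarrow> bs] f x"
    by (simp add: translate_average_def divide_inverse sum_list_mult_const sum_list_const_mult mult_ac)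
qed

text \<open>
  The invariant integral of \<open>f\<close> without measure theory: an average of translates has the same
  integral as \<open>f\<close>, hence a constant that such averages approach uniformly can only be the integral.
\<close>

definition has_mean :: "('g::ab_group_add \<Rightarrow> real) \<Rightarrow> real \<Rightarrow> bool" where
  "has_mean f c \<longleftrightarrow> (\<forall>e>0. \<exists>as. as \<noteq> [] \<and> (\<forall>x. \<bar>translate_average as f x - c\<bar> \<le> e))"

definition mean :: "('g::ab_group_add \<Rightarrow> real) \<Rightarrow> real" where
  "mean f = (THE c. has_mean f c)"

lemma translate_average_near:
  assumes "as \<noteq> []" "\<And>x. \<bar>f x - c\<bar> \<le> e"
  shows "\<bar>translate_average as f x - c\<bar> \<le> e"
  using translate_average_abs_le[of as "\<lambda>x. f x - c" e x] assms
  by (simp add: translate_average_minus_const)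

text \<open>
  One list serves finitely many functions: averages commute, and a further average of a function that
  is already close to a constant stays close to that constant. So the composition of the averages that
  are good for the single functions is good for all of them.
\<close>

lemma has_mean_common:
  assumes "finite A" "\<And>i. i \<in> A \<Longrightarrow> has_mean (f i) (c i)" "e > 0"
  shows "\<exists>as. as \<noteq> [] \<and> (\<forall>i\<in>A. \<forall>x. \<bar>translate_average as (f i) x - c i\<bar> \<le> e)"
  using assms
proof (induction A rule: finite_induct)
  case empty
  then show ?case by (intro exI[of _ "[0]"]) auto
next
  case (insert j A)
  then obtain as where as: "as \<noteq> []" "\<And>i x. i \<in> A \<Longrightarrow> \<bar>translate_average as (f i) x - c i\<bar> \<le> e"
    by auto
  obtain bs where bs: "bs \<noteq> []" "\<And>x. \<bar>translate_average bs (f j) x - c j\<bar> \<le> e"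
    using insert.prems(1)[of j] insert.prems(2) unfolding has_mean_def by blast
  let ?cs = "[a + b. a \<leftarrow> as, b \<leftarrow> bs]"
  have "?cs \<noteq> []" using as(1) bs(1) by (cases as; cases bs) auto
  moreover have "\<bar>translate_average ?cs (f i) x - c i\<bar> \<le> e" if "i \<in> insert j A" for i x
  proof (cases "i = j")
    case True
    then show ?thesis
      using translate_average_near[OF as(1), of "translate_average bs (f j)" "c j" e x] bs(2)
      by (simp add: translate_average_compose)
  next
    case False
    then have "i \<in> A" using that by auto
    then show ?thesis
      using translate_average_near[OF bs(1), of "translate_average as (f i)" "c i" e x] as(2)
      by (simp flip: translate_average_compose add: translate_average_commute[of as])
  qed
  ultimately show ?case by blast
qed

lemma has_mean_common2:
  assumes "has_mean f c" "has_mean g d" "e > 0"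
  obtains as where "as \<noteq> []" "\<And>x. \<bar>translate_average as f x - c\<bar> \<le> e"
    "\<And>x. \<bar>translate_average as g x - d\<bar> \<le> e"
proof -
  have "\<exists>as. as \<noteq> [] \<and> (\<forall>i\<in>{True, False}. \<forall>x.
      \<bar>translate_average as (if i then f else g) x - (if i then c else d)\<bar> \<le> e)"
    by (rule has_mean_common) (use assms in auto)
  then obtain as where "as \<noteq> []" and *: "\<forall>i\<in>{True, False}. \<forall>x.
      \<bar>translate_average as (if i then f else g) x - (if i then c else d)\<bar> \<le> e" by blast
  then show ?thesis using that *[rule_format, of True] *[rule_format, of False] by auto
qed

lemma has_mean_unique:
  assumes "has_mean f c" "has_mean f d"
  shows "c = d"
proof (rule ccontr)
  assume "c \<noteq> d"
  define e where "e = \<bar>c - d\<bar> / 3"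
  have e: "e > 0" using \<open>c \<noteq> d\<close> by (simp add: e_def)
  obtain as where "as \<noteq> []" and near: "\<And>x. \<bar>translate_average as f x - c\<bar> \<le> e"
    "\<And>x. \<bar>translate_average as f x - d\<bar> \<le> e"
    by (rule has_mean_common2[OF assms e]) (rule that)
  from near(1)[of 0] near(2)[of 0] have "\<bar>c - d\<bar> \<le> e + e" by linarith
  then show False using \<open>c \<noteq> d\<close> by (simp add: e_def)
qed

lemma mean_eqI: "has_mean f c \<Longrightarrow> mean f = c"
  unfolding mean_def by (blast intro: has_mean_unique)

lemma has_mean_add:
  assumes "has_mean f c" "has_mean g d"
  shows "has_mean (\<lambda>x. f x + g x) (c + d)"
  unfolding has_mean_def
proof (intro allI impI)
  fix e :: real assume e: "e > 0"
  obtain as where as: "as \<noteq> []" "\<And>x. \<bar>translate_average as f x - c\<bar> \<le> e / 2"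
    "\<And>x. \<bar>translate_average as g x - d\<bar> \<le> e / 2"
    by (rule has_mean_common2[OF assms half_gt_zero[OF e]]) (rule that)
  have "\<bar>translate_average as (\<lambda>x. f x + g x) x - (c + d)\<bar> \<le> e" for x
    using as(2)[of x] as(3)[of x] unfolding translate_average_add by linarith
  with as(1) show "\<exists>as. as \<noteq> [] \<and> (\<forall>x. \<bar>translate_average as (\<lambda>x. f x + g x) x - (c + d)\<bar> \<le> e)"
    by blast
qed

lemma has_mean_cmult:
  assumes "has_mean f c"
  shows "has_mean (\<lambda>x. b * f x) (b * c)"
  unfolding has_mean_def
proof (intro allI impI)
  fix e :: real assume e: "e > 0"
  then obtain as where as: "as \<noteq> []" "\<And>x. \<bar>translate_average as f x - c\<bar> \<le> e / (\<bar>b\<bar> + 1)"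
    using assms unfolding has_mean_def by (meson abs_ge_zero add_nonneg_pos divide_pos_pos zero_less_one)
  have "\<bar>translate_average as (\<lambda>x. b * f x) x - b * c\<bar> \<le> e" for x
  proof -
    have "\<bar>translate_average as (\<lambda>x. b * f x) x - b * c\<bar> = \<bar>b\<bar> * \<bar>translate_average as f x - c\<bar>"
      by (simp add: translate_average_cmult abs_mult flip: right_diff_distrib)
    also have "\<dots> \<le> (\<bar>b\<bar> + 1) * (e / (\<bar>b\<bar> + 1))"
      using as(2)[of x] by (intro mult_mono) auto
    finally show ?thesis by simp
  qed
  with as(1) show "\<exists>as. as \<noteq> [] \<and> (\<forall>x. \<bar>translate_average as (\<lambda>x. b * f x) x - b * c\<bar> \<le> e)"
    by blast
qed

lemma has_mean_const: "has_mean (\<lambda>x. c) c"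
  unfolding has_mean_def by (auto intro!: exI[of _ "[0]"] simp: translate_average_const)

lemma has_mean_shift:
  assumes "has_mean f c"
  shows "has_mean (\<lambda>x. f (x + b)) c"
  using assms unfolding has_mean_def translate_average_shift by blast

lemma has_mean_ge:
  assumes "has_mean f c" "\<And>x. b \<le> f x"
  shows "b \<le> c"
proof (rule field_le_epsilon)
  fix e :: real assume e: "e > 0"
  then obtain as where as: "as \<noteq> []" "\<And>x. \<bar>translate_average as f x - c\<bar> \<le> e"
    using assms unfolding has_mean_def by meson
  show "b \<le> c + e" using as(2)[of 0] translate_average_ge[OF as(1), of b f 0, OF assms(2)] by linarith
qed

text \<open>
  All averages of \<open>f\<close> inherit the neighbourhood of this lemma, which makes the set of these averages
  equicontinuous.
\<close>

lemma uniformly_small_translates: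
  fixes f :: "'g::topological_ab_group_add \<Rightarrow> real"
  assumes "compact (UNIV :: 'g set)" "continuous_on UNIV f" "e > 0"
  obtains U where "open U" "0 \<in> U" "\<And>u y. u \<in> U \<Longrightarrow> \<bar>f (u + y) - f y\<bar> \<le> e"
proof -
  have "continuous_on (UNIV \<times> UNIV) (\<lambda>(x,y). f (x + y))"
    unfolding case_prod_beta
    by (intro continuous_on_compose2[OF assms(2)] continuous_intros) auto
  from continuous_on_prod_compactE[OF this assms(1), of 0 e] assms(3)
  obtain X0 where "0 \<in> X0" "open X0" "\<forall>x\<in>X0 \<inter> UNIV. \<forall>t\<in>UNIV. dist (f (x + t)) (f (0 + t)) \<le> e"
    by auto
  then show ?thesis by (intro that[of X0]) (auto simp: dist_real_def)
qed

lemma finitely_many_translates_cover: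
  fixes U :: "'g::topological_ab_group_add set"
  assumes "compact (UNIV :: 'g set)" "open U" "0 \<in> U"
  obtains bs where "bs \<noteq> []" "\<And>x. \<exists>b\<in>set bs. x + b \<in> U"
proof -
  have "open ((\<lambda>x. x + b) -` U)" for b
    using assms(2) by (intro open_vimage continuous_intros)
  moreover have "UNIV \<subseteq> (\<Union>b. (\<lambda>x. x + b) -` U)"
  proof
    fix x :: 'g
    have "x \<in> (\<lambda>x. x + (- x)) -` U" using assms(3) by simp
    then show "x \<in> (\<Union>b. (\<lambda>x. x + b) -` U)" by blast
  qed
  ultimately obtain B where B: "finite B" "UNIV \<subseteq> (\<Union>b\<in>B. (\<lambda>x. x + b) -` U)"
    using compactE_image[OF assms(1), of UNIV "\<lambda>b. (\<lambda>x. x + b) -` U"] by auto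
  obtain bs where bs: "set bs = B" using finite_list[OF B(1)] by auto
  show ?thesis
  proof (rule that)
    show "bs \<noteq> []" using B bs by auto
  qed (use B bs in blast)
qed

lemma continuous_on_compact_UNIV_bounded:
  fixes f :: "'g::topological_space \<Rightarrow> 'b::real_normed_vector"
  assumes "compact (UNIV :: 'g set)" "continuous_on UNIV f"
  obtains B where "B > 0" "\<And>x. norm (f x) \<le> B"
proof -
  have "bounded (range f)" using compact_continuous_image[OF assms(2,1)] compact_imp_bounded by blast
  then show ?thesis using that by (auto simp: bounded_pos)
qed

text \<open>
  Let \<open>m\<close> be the infimum of the upper bounds of all averages of \<open>f\<close>, and let the average \<open>g\<close> be bounded
  by hardly more than \<open>m\<close>. If \<open>g\<close> fell clearly below \<open>m\<close> at one point, then it would do so on a whole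
  translate of a neighbourhood of 0 that does not depend on \<open>g\<close>. Finitely many translates of this
  neighbourhood cover the group, so averaging \<open>g\<close> over them would carry the dip to every point and
  yield an average with an upper bound below \<open>m\<close>. Hence \<open>g\<close> is uniformly close to \<open>m\<close>.
\<close>

lemma has_mean_exists:
  fixes f :: "'g::topological_ab_group_add \<Rightarrow> real"
  assumes comp: "compact (UNIV :: 'g set)" and cont: "continuous_on UNIV f"
  shows "\<exists>c. has_mean f c"
proof -
  obtain B where B: "\<And>x. \<bar>f x\<bar> \<le> B" using continuous_on_compact_UNIV_bounded[OF comp cont] by (metis real_norm_def)
  define S where "S = {c. \<exists>as. as \<noteq> [] \<and> (\<forall>x. translate_average as f x \<le> c)}"
  define m where "m = Inf S"
  have bdd: "bdd_below S"
  proof (rule bdd_belowI)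
    fix c assume "c \<in> S"
    then obtain as where "as \<noteq> []" "\<And>x. translate_average as f x \<le> c" by (auto simp: S_def)
    moreover have "- B \<le> f x" for x using B[of x] by linarith
    ultimately show "- B \<le> c"
      using translate_average_ge[of as "-B" f 0] by (meson order_trans)
  qed
  have "translate_average [0] f x \<le> B" for x
    using B[of x] by (simp add: translate_average_def)
  then have "B \<in> S" unfolding S_def by blast
  then have ne: "S \<noteq> {}" by blast
  have "has_mean f m"
    unfolding has_mean_def
  proof (intro allI impI)
    fix \<eta> :: real assume \<eta>: "\<eta> > 0"
    obtain U where U: "open U" "0 \<in> U" "\<And>u y. u \<in> U \<Longrightarrow> \<bar>f (u + y) - f y\<bar> \<le> \<eta> / 2"
      by (rule uniformly_small_translates[OF comp cont half_gt_zero[OF \<eta>]]) (rule that)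
    obtain bs where bs: "bs \<noteq> []" "\<And>x. \<exists>b\<in>set bs. x + b \<in> U"
      by (rule finitely_many_translates_cover[OF comp U(1,2)]) (rule that)
    define N where "N = real (length bs)"
    have N: "N \<ge> 1" using bs(1) unfolding N_def by (cases bs) auto
    \<comment> \<open>The dip will lower the bound by \<open>\<eta> / (2 * N)\<close>, which is twice this margin.\<close>
    define \<delta> where "\<delta> = \<eta> / (4 * N)"
    have \<delta>: "\<delta> > 0" "N * \<delta> < \<eta> / 2" "\<delta> \<le> \<eta>" using \<eta> N by (auto simp: \<delta>_def field_simps)
    obtain c where "c \<in> S" "c < m + \<delta>"
      using cInf_lessD[OF ne, of "m + \<delta>"] \<delta>(1) by (auto simp: m_def)
    then obtain as where as: "as \<noteq> []" "\<And>x. translate_average as f x < m + \<delta>"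
      unfolding S_def by (blast intro: le_less_trans)
    define g where "g = translate_average as f"
    have gU: "\<bar>g (u + y) - g y\<bar> \<le> \<eta> / 2" if "u \<in> U" for u y
    proof -
      have "g (u + y) - g y = translate_average as (\<lambda>y. f (u + y) - f y) y"
        using translate_average_add[of as "\<lambda>y. f (u + y)" "\<lambda>y. - f y" y]
          translate_average_shift[of as f u y]
        by (simp add: translate_average_uminus g_def add.commute)
      then show ?thesis
        using translate_average_abs_le[OF as(1), of "\<lambda>y. f (u + y) - f y", OF U(3)[OF that]] by metis
    qed
    have "m - \<eta> \<le> g x" for x
    proof (rule ccontr)
      assume "\<not> m - \<eta> \<le> g x"
      then have gx: "g x < m - \<eta>" by simp
      have "translate_average bs g y \<le> m + \<delta> - \<eta> / (2 * N)" for y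
      proof -
        obtain b where b: "b \<in> set bs" "(y - x) + b \<in> U" using bs(2) by blast
        have "g (y + b) \<le> m - \<eta> / 2"
          using abs_le_D1[OF gU[OF b(2), of x]] gx by (simp add: algebra_simps)
        moreover have "(\<Sum>a\<leftarrow>bs. g (y + a)) = g (y + b) + (\<Sum>a\<leftarrow>remove1 b bs. g (y + a))"
          by (rule sum_list_map_remove1[OF b(1)])
        moreover have "(\<Sum>a\<leftarrow>remove1 b bs. g (y + a)) \<le> (\<Sum>a\<leftarrow>remove1 b bs. m + \<delta>)"
          unfolding g_def by (intro sum_list_bounds less_imp_le as(2))
        moreover have "(\<Sum>a\<leftarrow>remove1 b bs. m + \<delta>) = (N - 1) * (m + \<delta>)"
          using b(1) N by (simp add: sum_list_triv length_remove1 N_def of_nat_diff)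
        ultimately have "(\<Sum>a\<leftarrow>bs. g (y + a)) \<le> (N - 1) * (m + \<delta>) + (m - \<eta> / 2)" by linarith
        also have "\<dots> \<le> N * (m + \<delta> - \<eta> / (2 * N))" using N \<delta>(1) by (simp add: field_simps)
        finally have "(\<Sum>a\<leftarrow>bs. g (y + a)) \<le> (m + \<delta> - \<eta> / (2 * N)) * N" by (simp only: mult.commute)
        then show ?thesis
          unfolding translate_average_def N_def[symmetric] using N by (subst pos_divide_le_eq) auto
      qed
      moreover have cs: "[b + a. b \<leftarrow> bs, a \<leftarrow> as] \<noteq> []" using as(1) bs(1) by (cases as; cases bs) auto
      ultimately have "m + \<delta> - \<eta> / (2 * N) \<in> S"
        unfolding S_def g_def translate_average_compose using cs by blast
      then have "m \<le> m + \<delta> - \<eta> / (2 * N)" unfolding m_def using bdd by (rule cInf_lower)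
      moreover have "\<delta> < \<eta> / (2 * N)" using \<eta> N by (simp add: \<delta>_def field_simps)
      ultimately show False by simp
    qed
    moreover have "g x \<le> m + \<eta>" for x using as(2)[of x] \<delta>(3) by (simp add: g_def)
    ultimately have "\<bar>g x - m\<bar> \<le> \<eta>" for x by (smt (verit) abs_le_iff)
    then show "\<exists>as. as \<noteq> [] \<and> (\<forall>x. \<bar>translate_average as f x - m\<bar> \<le> \<eta>)"
      using as(1) unfolding g_def by blast
  qed
  then show ?thesis ..
qed

section \<open>Equicontinuity on compact spaces\<close>

lemma compact_finite_net:
  assumes comp: "compact (UNIV :: 'a::topological_space set)"
    and nbhd: "\<And>x::'a. \<exists>U. open U \<and> x \<in> U \<and> (\<forall>y\<in>U. R x y)"
  obtains P where "finite P" "\<And>y. \<exists>p\<in>P. R p y"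
proof -
  obtain U where U: "\<forall>x. open (U x) \<and> x \<in> U x \<and> (\<forall>y\<in>U x. R x y)"
    using choice[OF allI[OF nbhd]] ..
  obtain P where P: "finite P" "UNIV \<subseteq> (\<Union>x\<in>P. U x)"
  proof (rule compactE_image[OF comp, of UNIV U])
    show "open (U x)" for x using U by simp
    show "UNIV \<subseteq> (\<Union>x. U x)" using U by blast
  qed (rule that)
  show ?thesis
  proof (rule that[OF P(1)])
    fix y
    obtain p where "p \<in> P" "y \<in> U p" using P(2) by blast
    then show "\<exists>p\<in>P. R p y" using spec[OF U, of p] by blast
  qed
qed

text \<open>
  The domain need not be metrizable. Equicontinuity itself supplies, for every \<open>k\<close>, a finite set of
  points that controls all \<open>f n\<close> up to \<open>1 / (k + 1)\<close>. The union of these sets is countable, so a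
  diagonal subsequence converges on it, and the control makes this convergence uniform.
\<close>

lemma arzela_ascoli_subsequence:
  fixes f :: "nat \<Rightarrow> 'a::topological_space \<Rightarrow> 'b::euclidean_space"
  assumes comp: "compact (UNIV :: 'a set)"
    and bounded: "\<And>n x. norm (f n x) \<le> M"
    and equicont: "\<And>x e. e > 0 \<Longrightarrow> \<exists>U. open U \<and> x \<in> U \<and> (\<forall>y\<in>U. \<forall>n. dist (f n y) (f n x) \<le> e)"
  obtains g r where "strict_mono (r :: nat \<Rightarrow> nat)" "continuous_on UNIV g"
    "uniform_limit UNIV (\<lambda>n. f (r n)) g sequentially"
proof -
  have ex: "\<exists>P. finite P \<and> (\<forall>y. \<exists>p\<in>P. \<forall>n. dist (f n y) (f n p) \<le> inverse (real (Suc k)))" for k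
  proof -
    have "inverse (real (Suc k)) > 0" by simp
    note nbhd = equicont[OF this]
    obtain P where P: "finite P" "\<And>y. \<exists>p\<in>P. \<forall>n. dist (f n y) (f n p) \<le> inverse (real (Suc k))"
      by (rule compact_finite_net[OF comp nbhd]) (rule that)
    show ?thesis by (intro exI[of _ P] conjI allI P)
  qed
  obtain P where P': "\<forall>k. finite (P k) \<and> (\<forall>y. \<exists>p\<in>P k. \<forall>n. dist (f n y) (f n p) \<le> inverse (real (Suc k)))"
    using choice[OF allI[OF ex]] ..
  have P: "finite (P k)" "\<exists>p\<in>P k. \<forall>n. dist (f n y) (f n p) \<le> inverse (real (Suc k))" for k y
    using conjunct1[OF P'[THEN spec, of k]] conjunct2[OF P'[THEN spec, of k], THEN spec, of y] .
  have D: "countable (\<Union>k. P k)" using P(1) by (intro countable_UN) (auto intro: countable_finite)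
  obtain r :: "nat \<Rightarrow> nat" where
    r: "strict_mono r" "\<And>x. x \<in> (\<Union>k. P k) \<Longrightarrow> \<exists>l. (\<lambda>n. f (r n) x) \<longlonglongrightarrow> l"
    by (rule function_convergent_subsequence[OF D, of f M]) (rule bounded, rule that)
  define l where "l x = lim (\<lambda>n. f (r n) x)" for x
  have l: "(\<lambda>n. f (r n) x) \<longlonglongrightarrow> l x" if "x \<in> P k" for k x
    unfolding l_def convergent_LIMSEQ_iff[symmetric] convergent_def using r(2) that by blast
  have "uniformly_Cauchy_on UNIV (\<lambda>n. f (r n))"
  proof (rule uniformly_Cauchy_onI)
    fix e :: real assume e: "e > 0"
    obtain k where k: "inverse (real (Suc k)) < e / 4" using e reals_Archimedean[of "e/4"] by auto
    have "\<forall>p\<in>P k. \<forall>\<^sub>F n in sequentially. dist (f (r n) p) (l p) < e / 4"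
      using l e by (intro ballI tendstoD) auto
    then have "\<forall>\<^sub>F n in sequentially. \<forall>p\<in>P k. dist (f (r n) p) (l p) < e / 4"
      using P(1) by (simp add: eventually_ball_finite)
    then obtain N where N: "\<And>n p. n \<ge> N \<Longrightarrow> p \<in> P k \<Longrightarrow> dist (f (r n) p) (l p) < e / 4"
      unfolding eventually_sequentially by blast
    have "dist (f (r m) x) (f (r n) x) < e" if "m \<ge> N" "n \<ge> N" for m n x
    proof -
      obtain p where p: "p \<in> P k" "\<And>n. dist (f n x) (f n p) \<le> inverse (real (Suc k))" using P(2) by blast
      have "dist (f (r m) x) (f (r n) x) \<le> dist (f (r m) x) (f (r m) p) + dist (f (r m) p) (l p)
          + dist (f (r n) p) (l p) + dist (f (r n) x) (f (r n) p)"
        using dist_triangle[of "f (r m) x" "f (r n) x" "l p"] dist_triangle[of "f (r m) x" "l p" "f (r m) p"]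
          dist_triangle[of "l p" "f (r n) x" "f (r n) p"]
        by (simp add: dist_commute)
      with p(2)[of "r m"] p(2)[of "r n"] N[OF that(1) p(1)] N[OF that(2) p(1)] k show ?thesis by linarith
    qed
    then show "\<exists>N. \<forall>x\<in>UNIV. \<forall>m\<ge>N. \<forall>n\<ge>N. dist (f (r m) x) (f (r n) x) < e" by blast
  qed
  then obtain g where g: "uniform_limit UNIV (\<lambda>n. f (r n)) g sequentially"
    using Cauchy_uniformly_convergent uniformly_convergent_on_def by blast
  have "continuous_on UNIV (f n)" for n
    unfolding continuous_on_def
  proof (intro ballI tendstoI)
    fix x and e :: real assume "e > 0"
    then have "e / 2 > 0" by simp
    from equicont[OF this, of x] obtain U where "open U" "x \<in> U"
      "\<And>y. y \<in> U \<Longrightarrow> dist (f n y) (f n x) \<le> e / 2" by blast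
    moreover have "e / 2 < e" using \<open>e > 0\<close> by simp
    ultimately show "\<forall>\<^sub>F y in at x. dist (f n y) (f n x) < e"
      unfolding eventually_at_topological by (blast intro: le_less_trans)
  qed
  then have "continuous_on UNIV g" by (intro uniform_limit_theorem[OF _ g]) auto
  with r(1) g that show ?thesis by blast
qed

lemma continuous_on_compose_UNIV:
  "continuous_on UNIV f \<Longrightarrow> continuous_on UNIV g \<Longrightarrow> continuous_on UNIV (\<lambda>x. f (g x))"
  using continuous_on_compose2[of UNIV f UNIV g] by simp

lemma continuous_on_section:
  assumes "continuous_on UNIV (\<lambda>p. F (fst p) (snd p))"
  shows "continuous_on UNIV (F x)" "continuous_on UNIV (\<lambda>x. F x y)"
  using continuous_on_compose_UNIV[OF assms continuous_on_Pair[OF continuous_on_const continuous_on_id], of x]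
    continuous_on_compose_UNIV[OF assms continuous_on_Pair[OF continuous_on_id continuous_on_const], of y]
  by simp_all

lemma continuous_equicontinuous:
  fixes F :: "'a::topological_space \<Rightarrow> 'b::topological_space \<Rightarrow> real"
  assumes "compact (UNIV :: 'b set)" "continuous_on UNIV (\<lambda>p. F (fst p) (snd p))" "e > 0"
  shows "\<exists>U. open U \<and> x \<in> U \<and> (\<forall>x'\<in>U. \<forall>y. \<bar>F x' y - F x y\<bar> \<le> e)"
proof -
  have "continuous_on (UNIV \<times> UNIV) (\<lambda>p. F (fst p) (snd p))" using assms(2) by simp
  from continuous_on_prod_compactE[OF this assms(1) UNIV_I assms(3), of x]
  obtain U where "x \<in> U" "open U" and
    *: "\<forall>x'\<in>U \<inter> UNIV. \<forall>y\<in>UNIV. dist (F (fst (x', y)) (snd (x', y))) (F (fst (x, y)) (snd (x, y))) \<le> e"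
    by blast
  moreover have "\<bar>F x' y - F x y\<bar> \<le> e" if "x' \<in> U" for x' y
    using *[rule_format, of x' y] that by (simp add: dist_real_def)
  ultimately show ?thesis by blast
qed


section \<open>The invariant mean\<close>

context
  assumes compact_UNIV: "compact (UNIV :: 'g::topological_ab_group_add set)"
begin

lemma has_mean_mean: "continuous_on UNIV (f :: 'g \<Rightarrow> real) \<Longrightarrow> has_mean f (mean f)"
  using has_mean_exists[OF compact_UNIV] mean_eqI by metis

lemma mean_const: "mean (\<lambda>_::'g. c) = c"
  by (intro mean_eqI has_mean_const)

lemma mean_add:
  "continuous_on UNIV (f :: 'g \<Rightarrow> real) \<Longrightarrow> continuous_on UNIV g \<Longrightarrow>
    mean (\<lambda>x. f x + g x) = mean f + mean g"
  by (rule mean_eqI[OF has_mean_add[OF has_mean_mean has_mean_mean]])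

lemma mean_cmult: "continuous_on UNIV (f :: 'g \<Rightarrow> real) \<Longrightarrow> mean (\<lambda>x. c * f x) = c * mean f"
  by (rule mean_eqI[OF has_mean_cmult[OF has_mean_mean]])

lemma mean_diff:
  assumes "continuous_on UNIV (f :: 'g \<Rightarrow> real)" "continuous_on UNIV g"
  shows "mean (\<lambda>x. f x - g x) = mean f - mean g"
  using mean_add[of f "\<lambda>x. - 1 * g x"] mean_cmult[of g "- 1"] assms by (simp add: continuous_on_minus)

lemma mean_shift: "continuous_on UNIV (f :: 'g \<Rightarrow> real) \<Longrightarrow> mean (\<lambda>x. f (x + a)) = mean f"
  by (rule mean_eqI[OF has_mean_shift[OF has_mean_mean]])

lemma mean_sum_list:
  "(\<And>i. continuous_on UNIV (f i :: 'g \<Rightarrow> real)) \<Longrightarrow>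
    mean (\<lambda>x. \<Sum>i\<leftarrow>is. f i x) = (\<Sum>i\<leftarrow>is. mean (f i))"
proof (induction "is")
  case Nil
  then show ?case by (simp add: mean_const)
next
  case (Cons i "is")
  have "continuous_on UNIV (\<lambda>x. \<Sum>i\<leftarrow>is. f i x)" for "is"
    using Cons.prems by (induction "is") (auto intro!: continuous_intros)
  then have "mean (\<lambda>x. f i x + (\<Sum>i\<leftarrow>is. f i x)) = mean (f i) + mean (\<lambda>x. \<Sum>i\<leftarrow>is. f i x)"
    by (intro mean_add Cons.prems)
  with Cons show ?case by simp
qed

lemma mean_ge: "continuous_on UNIV (f :: 'g \<Rightarrow> real) \<Longrightarrow> (\<And>x. c \<le> f x) \<Longrightarrow> c \<le> mean f"
  by (rule has_mean_ge[OF has_mean_mean])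

lemma mean_mono:
  assumes "continuous_on UNIV (f :: 'g \<Rightarrow> real)" "continuous_on UNIV g" "\<And>x. f x \<le> g x"
  shows "mean f \<le> mean g"
  using mean_ge[of "\<lambda>x. g x - f x" 0] mean_diff[of g f] assms by (simp add: continuous_on_diff)

lemma mean_dist_le:
  assumes "continuous_on UNIV (f :: 'g \<Rightarrow> real)" "continuous_on UNIV g" "\<And>x. \<bar>f x - g x\<bar> \<le> e"
  shows "\<bar>mean f - mean g\<bar> \<le> e"
proof -
  have "f x - g x \<le> e" "- e \<le> f x - g x" for x
    using abs_le_D1[OF assms(3)[of x]] abs_le_D2[OF assms(3)[of x]] by linarith+
  then have "mean (\<lambda>x. f x - g x) \<le> mean (\<lambda>_::'g. e)" "mean (\<lambda>_::'g. - e) \<le> mean (\<lambda>x. f x - g x)"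
    by (intro mean_mono continuous_intros assms(1,2); simp)+
  then show ?thesis using mean_diff[OF assms(1,2)] by (simp add: mean_const abs_le_iff)
qed

lemma mean_abs_le:
  "continuous_on UNIV (f :: 'g \<Rightarrow> real) \<Longrightarrow> (\<And>x. \<bar>f x\<bar> \<le> e) \<Longrightarrow> \<bar>mean f\<bar> \<le> e"
  using mean_dist_le[of f "\<lambda>_. 0" e, OF _ continuous_on_const] by (simp add: mean_const)

lemma mean_translate_average:
  assumes "continuous_on UNIV (f :: 'g \<Rightarrow> real)" "bs \<noteq> []"
  shows "has_mean (translate_average bs f) (mean f)"
  unfolding has_mean_def
proof (intro allI impI)
  fix e :: real assume "e > 0"
  then obtain as where as: "as \<noteq> []" "\<And>x. \<bar>translate_average as f x - mean f\<bar> \<le> e"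
    using has_mean_mean[OF assms(1)] unfolding has_mean_def by meson
  then show "\<exists>as. as \<noteq> [] \<and> (\<forall>x. \<bar>translate_average as (translate_average bs f) x - mean f\<bar> \<le> e)"
    using translate_average_near[OF assms(2) as(2)] by (auto simp: translate_average_commute[of _ bs])
qed

text \<open>
  Translates of a neighbourhood on which \<open>f\<close> stays above \<open>f x0 / 2\<close> cover the group. The average of \<open>f\<close>
  over these finitely many translates is bounded below by a positive constant, and it has the same
  mean as \<open>f\<close>.
\<close>

lemma mean_pos:
  assumes cont: "continuous_on UNIV (f :: 'g \<Rightarrow> real)" and nonneg: "\<And>x. 0 \<le> f x" and pos: "0 < f x0"
  shows "0 < mean f"
proof -
  have pos2: "f x0 / 2 > 0" using pos by simp
  obtain U where U: "open U" "0 \<in> U" "\<And>u y. u \<in> U \<Longrightarrow> \<bar>f (u + y) - f y\<bar> \<le> f x0 / 2"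
    by (rule uniformly_small_translates[OF compact_UNIV cont pos2]) (rule that)
  obtain bs where bs: "bs \<noteq> []" "\<And>x. \<exists>b\<in>set bs. x + b \<in> U"
    by (rule finitely_many_translates_cover[OF compact_UNIV U(1,2)]) (rule that)
  have len: "real (length bs) > 0" using bs(1) by simp
  have "f x0 / 2 / length bs \<le> translate_average bs f x" for x
  proof -
    obtain b where b: "b \<in> set bs" "(x - x0) + b \<in> U" using bs(2) by blast
    have "x - x0 + b + x0 = x + b" by simp
    then have "\<bar>f (x + b) - f x0\<bar> \<le> f x0 / 2" using U(3)[OF b(2), of x0] by metis
    from abs_le_D2[OF this] have "f x0 / 2 \<le> f (x + b)" by simp
    also have "\<dots> \<le> (\<Sum>a\<leftarrow>bs. f (x + a))"
    proof -
      have "0 \<le> (\<Sum>a\<leftarrow>remove1 b bs. f (x + a))"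
        by (rule sum_list_nonneg) (use nonneg in auto)
      then show ?thesis using sum_list_map_remove1[OF b(1), of "\<lambda>a. f (x + a)"] by simp
    qed
    finally show ?thesis
      using len unfolding translate_average_def by (intro divide_right_mono) auto
  qed
  then have "f x0 / 2 / length bs \<le> mean f"
    using has_mean_ge[OF mean_translate_average[OF cont bs(1)]] by blast
  moreover have "f x0 / 2 / length bs > 0" using pos2 len by simp
  ultimately show ?thesis by linarith
qed

lemma continuous_on_mean:
  assumes F: "continuous_on UNIV (\<lambda>p. F (fst p) (snd p))"
  shows "continuous_on UNIV (\<lambda>x. mean (F x :: 'g \<Rightarrow> real))"
  unfolding continuous_on_def
proof (intro ballI tendstoI)
  fix x and e :: real assume e: "e > 0"
  obtain U where U: "open U" "x \<in> U" "\<And>x' y. x' \<in> U \<Longrightarrow> \<bar>F x' y - F x y\<bar> \<le> e / 2"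
    using continuous_equicontinuous[OF compact_UNIV F half_gt_zero[OF e], of x] by blast
  have "dist (mean (F x')) (mean (F x)) < e" if "x' \<in> U" for x'
    using mean_dist_le[OF continuous_on_section(1)[OF F] continuous_on_section(1)[OF F] U(3)[OF that]] e
    by (simp add: dist_real_def)
  then show "\<forall>\<^sub>F y in at x. dist (mean (F y)) (mean (F x)) < e"
    unfolding eventually_at_topological using U(1,2) by blast
qed

text \<open>
  Up to a small error only finitely many of the functions \<open>F x\<close> are different, so a single average in
  the second variable approximates all inner means at once. A finite average may be exchanged with
  the outer mean by linearity.
\<close>

lemma mean_swap:
  fixes F :: "'g \<Rightarrow> 'g \<Rightarrow> real"
  assumes F: "continuous_on UNIV (\<lambda>p. F (fst p) (snd p))"
  shows "mean (\<lambda>x. mean (F x)) = mean (\<lambda>y. mean (\<lambda>x. F x y))"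
proof -
  note sec = continuous_on_section[OF F]
  have F': "continuous_on UNIV (\<lambda>p. F (snd p) (fst p))"
    using continuous_on_compose_UNIV[OF F continuous_on_Pair[OF continuous_on_snd continuous_on_fst,
      OF continuous_on_id continuous_on_id]]
    by simp
  note cm = continuous_on_mean[OF F]
  note cm' = continuous_on_mean[of "\<lambda>y x. F x y", OF F']
  have "\<bar>mean (\<lambda>x. mean (F x)) - mean (\<lambda>y. mean (\<lambda>x. F x y))\<bar> \<le> 4 * e" if e: "e > 0" for e
  proof -
    obtain P where P: "finite P" "\<And>x. \<exists>p\<in>P. \<forall>y. \<bar>F x y - F p y\<bar> \<le> e"
      by (rule compact_finite_net[OF compact_UNIV continuous_equicontinuous[OF compact_UNIV F e]]) (rule that)
    \<comment> \<open>\<open>None\<close> adds the function whose mean is the right-hand side to the common approximation.\<close>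
    define f where "f i = (case i of None \<Rightarrow> (\<lambda>y. mean (\<lambda>x. F x y)) | Some p \<Rightarrow> F p)" for i
    have "has_mean (f i) (mean (f i))" for i
    proof (cases i)
      case None
      then show ?thesis unfolding f_def using has_mean_mean[OF cm'] by simp
    next
      case (Some p)
      then show ?thesis unfolding f_def using has_mean_mean[OF sec(1)] by simp
    qed
    then obtain as where as: "as \<noteq> []"
        "\<And>i x. i \<in> insert None (Some ` P) \<Longrightarrow> \<bar>translate_average as (f i) x - mean (f i)\<bar> \<le> e"
      using has_mean_common[of "insert None (Some ` P)" f "\<lambda>i. mean (f i)" e] P(1) e by blast
    define A where "A x = translate_average as (F x) 0" for x
    have "\<bar>A x - mean (F x)\<bar> \<le> 3 * e" for x
    proof -
      obtain p where p: "p \<in> P" "\<And>y. \<bar>F x y - F p y\<bar> \<le> e" using P(2) by blast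
      have "\<bar>A x - A p\<bar> \<le> e"
        using translate_average_abs_le[OF as(1), of "\<lambda>y. F x y - F p y" e 0, OF p(2)]
          translate_average_add[of as "F x" "\<lambda>y. - F p y" 0]
        by (simp add: A_def translate_average_uminus)
      moreover have "\<bar>A p - mean (F p)\<bar> \<le> e"
        using as(2)[of "Some p" 0] p(1) by (simp add: A_def f_def)
      moreover have "\<bar>mean (F x) - mean (F p)\<bar> \<le> e" using mean_dist_le[OF sec(1) sec(1) p(2)] .
      ultimately show ?thesis by linarith
    qed
    moreover have csum: "continuous_on UNIV (\<lambda>x. \<Sum>a\<leftarrow>as. F x a)" for as
      by (induction as) (auto intro!: continuous_intros sec)
    then have "continuous_on UNIV A"
      by (simp add: A_def translate_average_def divide_inverse continuous_on_mult_right)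
    ultimately have 1: "\<bar>mean A - mean (\<lambda>x. mean (F x))\<bar> \<le> 3 * e"
      using cm by (intro mean_dist_le)
    have "A = (\<lambda>x. inverse (length as) * (\<Sum>a\<leftarrow>as. F x a))"
      by (simp add: fun_eq_iff A_def translate_average_def divide_inverse mult.commute)
    then have "mean A = inverse (length as) * mean (\<lambda>x. \<Sum>a\<leftarrow>as. F x a)"
      using mean_cmult[OF csum] by simp
    also have "mean (\<lambda>x. \<Sum>a\<leftarrow>as. F x a) = (\<Sum>a\<leftarrow>as. mean (\<lambda>x. F x a))"
      by (rule mean_sum_list[of "\<lambda>a x. F x a"]) (rule sec)
    also have "inverse (length as) * (\<Sum>a\<leftarrow>as. mean (\<lambda>x. F x a)) = translate_average as (f None) 0"
      by (simp add: f_def translate_average_def divide_inverse mult.commute)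
    finally have "\<bar>mean A - mean (\<lambda>y. mean (\<lambda>x. F x y))\<bar> \<le> e"
      using as(2)[of None 0] by (simp add: f_def)
    with 1 show ?thesis by linarith
  qed
  moreover define \<delta> where "\<delta> = \<bar>mean (\<lambda>x. mean (F x)) - mean (\<lambda>y. mean (\<lambda>x. F x y))\<bar>"
  ultimately have *: "\<delta> \<le> 4 * e" if "e > 0" for e using that by blast
  have "\<delta> \<le> 0" using *[of "\<delta> / 8"] by (cases "\<delta> > 0") auto
  then show ?thesis by (simp add: \<delta>_def)
qed

lemma mean_Cauchy_Schwarz:
  assumes f: "continuous_on UNIV (f :: 'g \<Rightarrow> real)" and g: "continuous_on UNIV g"
  shows "(mean (\<lambda>x. f x * g x))\<^sup>2 \<le> mean (\<lambda>x. (f x)\<^sup>2) * mean (\<lambda>x. (g x)\<^sup>2)"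
proof -
  define A B C where "A = mean (\<lambda>x. (f x)\<^sup>2)" and "B = mean (\<lambda>x. f x * g x)" and "C = mean (\<lambda>x. (g x)\<^sup>2)"
  have *: "0 \<le> A - 2 * t * B + t\<^sup>2 * C" for t
  proof -
    have "0 \<le> mean (\<lambda>x. ((f x)\<^sup>2 - (2 * t) * (f x * g x)) + t\<^sup>2 * (g x)\<^sup>2)"
    proof (rule mean_ge)
      fix x
      have "0 \<le> (f x - t * g x)\<^sup>2" by simp
      also have "(f x - t * g x)\<^sup>2 = ((f x)\<^sup>2 - (2 * t) * (f x * g x)) + t\<^sup>2 * (g x)\<^sup>2" by algebra
      finally show "0 \<le> ((f x)\<^sup>2 - (2 * t) * (f x * g x)) + t\<^sup>2 * (g x)\<^sup>2" .
    qed (intro continuous_intros f g)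
    also have "\<dots> = mean (\<lambda>x. (f x)\<^sup>2 - (2 * t) * (f x * g x)) + mean (\<lambda>x. t\<^sup>2 * (g x)\<^sup>2)"
      by (intro mean_add continuous_intros f g)
    also have "mean (\<lambda>x. (f x)\<^sup>2 - (2 * t) * (f x * g x)) = A - mean (\<lambda>x. (2 * t) * (f x * g x))"
      unfolding A_def by (intro mean_diff continuous_intros f g)
    also have "mean (\<lambda>x. (2 * t) * (f x * g x)) = 2 * t * B"
      unfolding B_def by (intro mean_cmult continuous_intros f g)
    also have "mean (\<lambda>x. t\<^sup>2 * (g x)\<^sup>2) = t\<^sup>2 * C"
      unfolding C_def by (intro mean_cmult continuous_intros g)
    finally show ?thesis .
  qed
  have C: "0 \<le> C" unfolding C_def by (intro mean_ge continuous_intros g) simp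
  show "B\<^sup>2 \<le> A * C"
  proof (cases "C = 0")
    case True
    have "B = 0"
    proof (rule ccontr)
      assume "B \<noteq> 0"
      then have "2 * ((A + 1) / (2 * B)) * B = A + 1" by simp
      with *[of "(A + 1) / (2 * B)"] True show False by simp
    qed
    then show ?thesis using True by simp
  next
    case False
    have "A - 2 * (B / C) * B + (B / C)\<^sup>2 * C = A - B\<^sup>2 / C"
      using False by (simp add: power2_eq_square)
    then have "B\<^sup>2 / C \<le> A" using *[of "B / C"] by simp
    then show ?thesis using C False by (simp add: pos_divide_le_eq)
  qed
qed

lemma mean_mult_le:
  assumes "continuous_on UNIV (F :: 'g \<Rightarrow> real)" "continuous_on UNIV f" "\<And>x. \<bar>F x\<bar> \<le> e"
  shows "(mean (\<lambda>x. F x * f x))\<^sup>2 \<le> e\<^sup>2 * mean (\<lambda>x. (f x)\<^sup>2)"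
proof -
  have "mean (\<lambda>x. (F x)\<^sup>2) \<le> mean (\<lambda>_::'g. e\<^sup>2)"
    by (intro mean_mono continuous_intros assms(1)) (metis abs_ge_zero assms(3) power2_abs power_mono)
  moreover have "0 \<le> mean (\<lambda>x. (f x)\<^sup>2)" by (intro mean_ge continuous_intros assms) simp
  ultimately show ?thesis
    using order_trans[OF mean_Cauchy_Schwarz[OF assms(1,2)] mult_right_mono] unfolding mean_const by metis
qed

end

section \<open>Convolution operators\<close>

definition convolve :: "('g::ab_group_add \<Rightarrow> real) \<Rightarrow> ('g \<Rightarrow> real) \<Rightarrow> 'g \<Rightarrow> real" where
  "convolve K f x = mean (\<lambda>y. K (x - y) * f y)"

context
  assumes compact_UNIV: "compact (UNIV :: 'g::topological_ab_group_add set)"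
begin

lemma mean_uniform_limit:
  fixes f :: "nat \<Rightarrow> 'g \<Rightarrow> real"
  assumes "uniform_limit UNIV f g sequentially" "\<And>n. continuous_on UNIV (f n)"
  shows "(\<lambda>n. mean (f n)) \<longlonglongrightarrow> mean g"
proof (rule LIMSEQ_I)
  fix e :: real assume e: "e > 0"
  have g: "continuous_on UNIV g"
    by (rule uniform_limit_theorem[OF _ assms(1)]) (auto simp: assms(2))
  from uniform_limitD[OF assms(1) half_gt_zero[OF e]] obtain N where
    N: "\<And>n x. n \<ge> N \<Longrightarrow> dist (f n x) (g x) < e / 2"
    unfolding eventually_sequentially by blast
  have "norm (mean (f n) - mean g) < e" if "n \<ge> N" for n
  proof -
    have "\<bar>f n x - g x\<bar> \<le> e / 2" for x using N[OF that, of x] by (simp add: dist_real_def)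
    from mean_dist_le[OF compact_UNIV assms(2) g this] show ?thesis using e by simp
  qed
  then show "\<exists>no. \<forall>n\<ge>no. norm (mean (f n) - mean g) < e" by blast
qed

lemma mean_square_nonneg: "continuous_on UNIV (f :: 'g \<Rightarrow> real) \<Longrightarrow> 0 \<le> mean (\<lambda>x. (f x)\<^sup>2)"
  by (rule mean_ge[OF compact_UNIV continuous_on_power]) auto

lemma mean_square_pos:
  "continuous_on UNIV (f :: 'g \<Rightarrow> real) \<Longrightarrow> f x \<noteq> 0 \<Longrightarrow> 0 < mean (\<lambda>x. (f x)\<^sup>2)"
  by (rule mean_pos[OF compact_UNIV continuous_on_power, where ?x0.0 = x]) auto

context
  fixes K :: "'g \<Rightarrow> real"
  assumes K: "continuous_on UNIV K"
begin

lemma continuous_on_convolve_integrand: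
  assumes f: "continuous_on UNIV f"
  shows "continuous_on UNIV (\<lambda>p. K (fst p - snd p) * f (snd p))"
    and "continuous_on UNIV (\<lambda>y. K (x - y) * f y)"
    and "continuous_on UNIV (\<lambda>y. K (x - y))"
    and "continuous_on UNIV (\<lambda>p. K (fst p - snd p))"
  by (intro continuous_intros continuous_on_compose_UNIV[OF K] continuous_on_compose_UNIV[OF f])+

lemma continuous_on_convolve:
  "continuous_on UNIV f \<Longrightarrow> continuous_on UNIV (convolve K f)"
  unfolding convolve_def[abs_def]
  by (rule continuous_on_mean[OF compact_UNIV continuous_on_convolve_integrand(1)])

lemma convolve_cmult:
  assumes "continuous_on UNIV f"
  shows "convolve K (\<lambda>y. c * f y) x = c * convolve K f x"
  using mean_cmult[OF compact_UNIV continuous_on_convolve_integrand(2)[OF assms], of c x]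
  by (simp add: convolve_def mult_ac)

lemma convolve_add:
  assumes f: "continuous_on UNIV f" and g: "continuous_on UNIV g"
  shows "convolve K (\<lambda>y. f y + g y) x = convolve K f x + convolve K g x"
  using mean_add[OF compact_UNIV continuous_on_convolve_integrand(2)[OF f] continuous_on_convolve_integrand(2)[OF g], of x x]
  by (simp add: convolve_def algebra_simps)

lemma convolve_diff:
  assumes f: "continuous_on UNIV f" and g: "continuous_on UNIV g"
  shows "convolve K (\<lambda>y. f y - g y) x = convolve K f x - convolve K g x"
  using mean_diff[OF compact_UNIV continuous_on_convolve_integrand(2)[OF f] continuous_on_convolve_integrand(2)[OF g], of x x]
  by (simp add: convolve_def algebra_simps)

lemma convolve_shift:
  assumes f: "continuous_on UNIV f"
  shows "convolve K (\<lambda>y. f (y + a)) x = convolve K f (x + a)"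
  using mean_shift[OF compact_UNIV continuous_on_convolve_integrand(2)[OF f], of "x + a" a]
  by (simp add: convolve_def algebra_simps)

lemma convolve_square_le:
  assumes f: "continuous_on UNIV f" and B: "\<And>x. \<bar>K x\<bar> \<le> B"
  shows "(convolve K f x)\<^sup>2 \<le> B\<^sup>2 * mean (\<lambda>x. (f x)\<^sup>2)"
  unfolding convolve_def
  by (rule mean_mult_le[OF compact_UNIV continuous_on_convolve_integrand(3)[OF f] f B])

lemma convolve_abs_le:
  assumes f: "continuous_on UNIV f" and B: "\<And>x. \<bar>K x\<bar> \<le> B" and C: "\<And>x. \<bar>f x\<bar> \<le> C"
  shows "\<bar>convolve K f x\<bar> \<le> B * C"
  unfolding convolve_def
proof (rule mean_abs_le[OF compact_UNIV continuous_on_convolve_integrand(2)[OF f]])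
  fix y
  have "0 \<le> B" using B[of 0] by linarith
  then show "\<bar>K (x - y) * f y\<bar> \<le> B * C" unfolding abs_mult by (intro mult_mono B C) auto
qed

text \<open>
  The unit ball of the mean-square norm is mapped to an equicontinuous set: this is the compactness of
  the convolution operator.
\<close>

lemma convolve_equicontinuous:
  assumes e: "e > 0"
  shows "\<exists>U. open U \<and> x \<in> U \<and> (\<forall>x'\<in>U. \<forall>f. continuous_on UNIV f \<longrightarrow> mean (\<lambda>x. (f x)\<^sup>2) \<le> 1 \<longrightarrow>
    \<bar>convolve K f x' - convolve K f x\<bar> \<le> e)"
proof -
  obtain U where U: "open U" "x \<in> U" "\<forall>x'\<in>U. \<forall>y. \<bar>K (x' - y) - K (x - y)\<bar> \<le> e"
    using continuous_equicontinuous[OF compact_UNIV continuous_on_convolve_integrand(4)[OF K] e, of x] by blast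
  have "\<bar>convolve K f x' - convolve K f x\<bar> \<le> e"
    if x': "x' \<in> U" and f: "continuous_on UNIV f" and f1: "mean (\<lambda>x. (f x)\<^sup>2) \<le> 1" for x' f
  proof -
    have "convolve K f x' - convolve K f x = mean (\<lambda>y. (K (x' - y) - K (x - y)) * f y)"
      using mean_diff[OF compact_UNIV continuous_on_convolve_integrand(2)[OF f] continuous_on_convolve_integrand(2)[OF f], of x' x]
      by (simp add: convolve_def algebra_simps)
    also have "(\<dots>)\<^sup>2 \<le> e\<^sup>2 * mean (\<lambda>x. (f x)\<^sup>2)"
      using U(3) x' by (intro mean_mult_le[OF compact_UNIV _ f] continuous_intros continuous_on_convolve_integrand(3)[OF f]) auto
    also have "\<dots> \<le> e\<^sup>2 * 1" by (intro mult_left_mono f1) simp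
    finally show ?thesis using e by (simp add: abs_le_square_iff[symmetric])
  qed
  with U(1,2) show ?thesis by blast
qed

lemma convolve_self_adjoint:
  assumes even: "\<And>x. K (- x) = K x" and f: "continuous_on UNIV f" and g: "continuous_on UNIV g"
  shows "mean (\<lambda>x. convolve K f x * g x) = mean (\<lambda>x. f x * convolve K g x)"
proof -
  have sym: "g x * (K (x - y) * f y) = f y * (K (y - x) * g x)" for x y
    using even[of "x - y"] by simp
  have "mean (\<lambda>x. convolve K f x * g x) = mean (\<lambda>x. mean (\<lambda>y. g x * (K (x - y) * f y)))"
    using mean_cmult[OF compact_UNIV continuous_on_convolve_integrand(2)[OF f]]
    by (simp add: convolve_def mult.commute)
  also have "\<dots> = mean (\<lambda>y. mean (\<lambda>x. g x * (K (x - y) * f y)))"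
    by (rule mean_swap[OF compact_UNIV])
      (intro continuous_intros continuous_on_compose_UNIV[OF K] continuous_on_compose_UNIV[OF f] continuous_on_compose_UNIV[OF g])
  also have "\<dots> = mean (\<lambda>y. mean (\<lambda>x. f y * (K (y - x) * g x)))" by (simp only: sym)
  also have "\<dots> = mean (\<lambda>y. f y * convolve K g y)"
    using mean_cmult[OF compact_UNIV continuous_on_convolve_integrand(2)[OF g]]
    by (simp add: convolve_def)
  finally show ?thesis .
qed

lemma convolve_uniform_limit:
  assumes lim: "uniform_limit UNIV f g sequentially" and f: "\<And>n. continuous_on UNIV (f n)"
  shows "uniform_limit UNIV (\<lambda>n. convolve K (f n)) (convolve K g) sequentially"
proof (rule uniform_limitI)
  fix e :: real assume e: "e > 0"
  obtain B where B: "B > 0" "\<And>x. \<bar>K x\<bar> \<le> B"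
    using continuous_on_compact_UNIV_bounded[OF compact_UNIV K] by (metis real_norm_def)
  have g: "continuous_on UNIV g"
    by (rule uniform_limit_theorem[OF _ lim]) (auto simp: f)
  have "e / (2 * B) > 0" using e B(1) by simp
  from uniform_limitD[OF lim this]
  show "\<forall>\<^sub>F n in sequentially. \<forall>x\<in>UNIV. dist (convolve K (f n) x) (convolve K g x) < e"
  proof eventually_elim
    case (elim n)
    then have "\<bar>f n x - g x\<bar> \<le> e / (2 * B)" for x by (simp add: dist_real_def less_imp_le)
    from convolve_abs_le[OF continuous_on_diff[OF f g] B(2) this]
    have "\<bar>convolve K (f n) x - convolve K g x\<bar> \<le> e / 2" for x
      using B(1) by (simp add: convolve_diff[OF f g])
    moreover have "e / 2 < e" using e by simp
    ultimately show ?case unfolding dist_real_def by (blast intro: le_less_trans)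
  qed
qed

text \<open>
  Write \<open>T\<close> for the convolution with \<open>K\<close> and \<open>s\<close> for the supremum of the mean square of \<open>T f\<close>, where \<open>f\<close>
  has mean square at most 1. Along a maximising sequence \<open>f n\<close>, compactness of \<open>T\<close> gives a uniform limit
  \<open>g\<close> of a subsequence of \<open>T (f n)\<close>. As \<open>T\<close> is self-adjoint, expanding the square shows that
  \<open>T (T (f n)) - s * f n\<close> tends to 0 in mean square, and one more application of \<open>T\<close> turns this into
  \<open>T (T g) = s * g\<close>. The square of \<open>T\<close> is used because its largest eigenvalue is the supremum of a
  nonnegative quadratic form, so that no sign has to be discussed.
\<close>

lemma convolve_square_eigenfunction_exists:
  assumes even: "\<And>x. K (- x) = K x" and nz: "K 0 \<noteq> 0"
  obtains s f x0 where "s > 0" "continuous_on UNIV f" "f x0 \<noteq> 0"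
    "\<And>x. convolve K (convolve K f) x = s * f x"
proof -
  note cc = continuous_on_convolve
  let ?T = "convolve K"
  define q :: "('g \<Rightarrow> real) \<Rightarrow> real" where "q f = mean (\<lambda>x. (f x)\<^sup>2)" for f
  obtain B where B: "B > 0" "\<And>x. \<bar>K x\<bar> \<le> B"
    using continuous_on_compact_UNIV_bounded[OF compact_UNIV K] by (metis real_norm_def)
  have q_nonneg: "0 \<le> q f" if "continuous_on UNIV f" for f
    unfolding q_def by (rule mean_square_nonneg[OF that])
  have T_sq: "(?T f x)\<^sup>2 \<le> B\<^sup>2 * q f" if "continuous_on UNIV f" for f x
    unfolding q_def by (rule convolve_square_le[OF that B(2)])
  have qT: "q (?T f) \<le> B\<^sup>2 * q f" if f: "continuous_on UNIV f" for f
  proof -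
    have "q (?T f) \<le> mean (\<lambda>_::'g. B\<^sup>2 * q f)"
      unfolding q_def[of "?T f"]
      by (rule mean_mono[OF compact_UNIV continuous_on_power[OF cc[OF f]] continuous_on_const T_sq[OF f]])
    then show ?thesis by (simp add: mean_const[OF compact_UNIV])
  qed
  define S where "S = {q (?T f) | f. continuous_on UNIV f \<and> q f \<le> 1}"
  define s where "s = Sup S"
  have bdd: "bdd_above S"
  proof (rule bdd_aboveI)
    fix c assume "c \<in> S"
    then obtain f where f: "continuous_on UNIV f" "q f \<le> 1" "c = q (?T f)" by (auto simp: S_def)
    have "B\<^sup>2 * q f \<le> B\<^sup>2 * 1" by (rule mult_left_mono[OF f(2)]) simp
    then show "c \<le> B\<^sup>2" using qT[OF f(1)] f(3) by simp
  qed
  have "q (\<lambda>_. 0) = 0" by (simp add: q_def mean_const[OF compact_UNIV])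
  then have ne: "S \<noteq> {}" unfolding S_def by (auto intro!: exI[of _ "\<lambda>_. 0"])
  have le_s: "q (?T f) \<le> s * q f" if f: "continuous_on UNIV f" for f
  proof (cases "q f = 0")
    case True
    then show ?thesis using qT[OF f] by simp
  next
    case False
    then have pos: "q f > 0" using q_nonneg[OF f] by simp
    define k where "k = inverse (sqrt (q f))"
    have k2: "k\<^sup>2 = inverse (q f)" using pos by (simp add: k_def power_inverse)
    have q_scale: "q (\<lambda>x. k * g x) = k\<^sup>2 * q g" if "continuous_on UNIV g" for g
      unfolding q_def power_mult_distrib by (rule mean_cmult[OF compact_UNIV continuous_on_power[OF that]])
    have "q (\<lambda>x. k * f x) \<le> 1" using q_scale[OF f] k2 pos by simp
    then have "q (?T (\<lambda>x. k * f x)) \<in> S"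
      unfolding S_def using continuous_on_mult_left[OF f] by blast
    then have "q (?T (\<lambda>x. k * f x)) \<le> s" unfolding s_def by (rule cSup_upper[OF _ bdd])
    moreover have "?T (\<lambda>x. k * f x) = (\<lambda>x. k * ?T f x)" using convolve_cmult[OF f] by blast
    ultimately have "k\<^sup>2 * q (?T f) \<le> s" using q_scale[OF cc[OF f]] by simp
    then show ?thesis using pos by (simp add: k2 field_simps)
  qed
  have qK: "q K > 0" unfolding q_def by (rule mean_square_pos[OF K nz])
  have "?T K 0 = q K" using even by (simp add: convolve_def q_def power2_eq_square)
  then have "q (?T K) > 0" unfolding q_def[of "?T K"] using qK by (intro mean_square_pos[OF cc[OF K], of 0]) simp
  then have "s * q K > 0" using le_s[OF K] by simp
  then have s: "s > 0" using qK by (simp add: zero_less_mult_iff)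
  have ex: "\<exists>f. continuous_on UNIV f \<and> q f \<le> 1 \<and> s - inverse (real (Suc n)) < q (?T f)" for n
  proof -
    have "s - inverse (real (Suc n)) < s" by simp
    then obtain c where "c \<in> S" "s - inverse (real (Suc n)) < c"
      using less_cSup_iff[OF ne bdd] unfolding s_def by blast
    then show ?thesis unfolding S_def by blast
  qed
  obtain f where f': "\<forall>n. continuous_on UNIV (f n) \<and> q (f n) \<le> 1 \<and> s - inverse (real (Suc n)) < q (?T (f n))"
    using choice[OF allI[OF ex]] ..
  have f: "continuous_on UNIV (f n)" "q (f n) \<le> 1" "s - inverse (real (Suc n)) < q (?T (f n))" for n
    using f' by simp_all
  have bound: "norm (?T (f n) x) \<le> B" for n x
  proof -
    have "B\<^sup>2 * q (f n) \<le> B\<^sup>2 * 1" by (rule mult_left_mono[OF f(2)]) simp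
    then have "(?T (f n) x)\<^sup>2 \<le> B\<^sup>2" using T_sq[OF f(1), of n x] by simp
    then show ?thesis using B(1) by (simp add: abs_le_square_iff[symmetric])
  qed
  have equi: "\<exists>U. open U \<and> x \<in> U \<and> (\<forall>y\<in>U. \<forall>n. dist (?T (f n) y) (?T (f n) x) \<le> e)" if "e > 0" for x e
    using convolve_equicontinuous[OF that, of x] f(1) f(2)[unfolded q_def] unfolding dist_real_def by meson
  obtain g r where r: "strict_mono (r :: nat \<Rightarrow> nat)" and g: "continuous_on UNIV g"
    and lim: "uniform_limit UNIV (\<lambda>n. ?T (f (r n))) g sequentially"
    by (rule arzela_ascoli_subsequence[of "\<lambda>n. ?T (f n)", OF compact_UNIV bound equi]) (assumption | rule that)+
  have inv0: "(\<lambda>n. inverse (real (Suc (r n)))) \<longlonglongrightarrow> 0"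
    using LIMSEQ_subseq_LIMSEQ[OF LIMSEQ_inverse_real_of_nat r] by (simp add: o_def)
  \<comment> \<open>The limit has mean square at least \<open>s\<close>, hence it does not vanish.\<close>
  have bg: "bounded (range g)"
    using continuous_on_compact_UNIV_bounded[OF compact_UNIV g] by (metis bounded_iff rangeE)
  have lim_q: "(\<lambda>n. q (?T (f (r n)))) \<longlonglongrightarrow> q g"
    unfolding q_def power2_eq_square
    by (rule mean_uniform_limit[OF uniform_lim_mult[OF lim lim bg bg]]) (intro continuous_intros cc f)
  have lim_s: "(\<lambda>n. s - inverse (real (Suc (r n)))) \<longlonglongrightarrow> s"
    using tendsto_diff[OF tendsto_const inv0, of s] by simp
  have "s \<le> q g"
    by (rule LIMSEQ_le[OF lim_s lim_q]) (use f(3) less_imp_le in blast)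
  have "\<exists>x0. g x0 \<noteq> 0"
  proof (rule ccontr)
    assume "\<not> (\<exists>x0. g x0 \<noteq> 0)"
    then have "q g = 0" by (simp add: q_def mean_const[OF compact_UNIV])
    with s \<open>s \<le> q g\<close> show False by simp
  qed
  then obtain x0 where x0: "g x0 \<noteq> 0" ..
  \<comment> \<open>By maximality the functions \<open>f (r n)\<close> are eigenfunctions up to an error that tends to 0 in mean square.\<close>
  define h where "h n = (\<lambda>x. ?T (?T (f (r n))) x - s * f (r n) x)" for n
  have ch: "continuous_on UNIV (h n)" for n unfolding h_def by (intro continuous_intros cc f)
  have qh: "q (h n) \<le> s * inverse (real (Suc (r n)))" for n
  proof -
    let ?f = "f (r n)"
    have "q (h n) = mean (\<lambda>x. ((?T (?T ?f) x)\<^sup>2 - (2 * s) * (?T (?T ?f) x * ?f x)) + s\<^sup>2 * (?f x)\<^sup>2)"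
      unfolding q_def h_def by (simp add: power2_eq_square algebra_simps)
    also have "\<dots> = mean (\<lambda>x. (?T (?T ?f) x)\<^sup>2 - (2 * s) * (?T (?T ?f) x * ?f x)) + mean (\<lambda>x. s\<^sup>2 * (?f x)\<^sup>2)"
      by (intro mean_add[OF compact_UNIV] continuous_intros cc f)
    also have "mean (\<lambda>x. (?T (?T ?f) x)\<^sup>2 - (2 * s) * (?T (?T ?f) x * ?f x))
        = q (?T (?T ?f)) - mean (\<lambda>x. (2 * s) * (?T (?T ?f) x * ?f x))"
      unfolding q_def by (intro mean_diff[OF compact_UNIV] continuous_intros cc f)
    also have "mean (\<lambda>x. (2 * s) * (?T (?T ?f) x * ?f x)) = (2 * s) * mean (\<lambda>x. ?T (?T ?f) x * ?f x)"
      by (intro mean_cmult[OF compact_UNIV] continuous_intros cc f)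
    also have "mean (\<lambda>x. ?T (?T ?f) x * ?f x) = q (?T ?f)"
      using convolve_self_adjoint[OF even cc[OF f(1)] f(1)] by (simp add: q_def power2_eq_square)
    also have "mean (\<lambda>x. s\<^sup>2 * (?f x)\<^sup>2) = s\<^sup>2 * q ?f"
      unfolding q_def by (intro mean_cmult[OF compact_UNIV] continuous_intros f)
    finally have "q (h n) = q (?T (?T ?f)) - 2 * s * q (?T ?f) + s\<^sup>2 * q ?f" .
    moreover have "q (?T (?T ?f)) \<le> s * q (?T ?f)" by (rule le_s[OF cc[OF f(1)]])
    moreover have "s\<^sup>2 * q ?f \<le> s\<^sup>2 * 1" by (rule mult_left_mono[OF f(2)]) simp
    moreover have "s * (s - inverse (real (Suc (r n)))) \<le> s * q (?T ?f)"
      using f(3)[of "r n"] s by (intro mult_left_mono) auto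
    ultimately show ?thesis by (simp add: power2_eq_square right_diff_distrib)
  qed
  have "?T (?T g) x = s * g x" for x
  proof -
    have lim1: "(\<lambda>n. ?T (?T (?T (f (r n)))) x - s * ?T (f (r n)) x) \<longlonglongrightarrow> ?T (?T g) x - s * g x"
      by (intro tendsto_intros tendsto_uniform_limitI[OF lim]
          tendsto_uniform_limitI[OF convolve_uniform_limit[OF convolve_uniform_limit[OF lim]]] cc f UNIV_I)
    have eq: "?T (?T (?T (f (r n)))) x - s * ?T (f (r n)) x = ?T (h n) x" for n
      unfolding h_def
      using convolve_diff[OF cc[OF cc[OF f(1)]] continuous_on_mult_left[OF f(1)], of "r n" s "r n" x]
        convolve_cmult[OF f(1), of s "r n" x] by simp
    have "(\<lambda>n. (?T (h n) x)\<^sup>2) \<longlonglongrightarrow> 0"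
    proof (rule tendsto_sandwich[OF _ _ tendsto_const])
      show "\<forall>\<^sub>F n in sequentially. 0 \<le> (?T (h n) x)\<^sup>2" by simp
      have "(?T (h n) x)\<^sup>2 \<le> B\<^sup>2 * (s * inverse (real (Suc (r n))))" for n
        using T_sq[OF ch, of n x] mult_left_mono[OF qh, of "B\<^sup>2" n] by simp
      then show "\<forall>\<^sub>F n in sequentially. (?T (h n) x)\<^sup>2 \<le> B\<^sup>2 * (s * inverse (real (Suc (r n))))" by simp
      show "(\<lambda>n. B\<^sup>2 * (s * inverse (real (Suc (r n))))) \<longlonglongrightarrow> 0"
        using tendsto_mult[OF tendsto_const[of "B\<^sup>2"] tendsto_mult[OF tendsto_const[of s] inv0]] by simp
    qed
    then have "(\<lambda>n. ?T (h n) x) \<longlonglongrightarrow> 0" by simp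
    with lim1 have "?T (?T g) x - s * g x = 0" unfolding eq by (rule LIMSEQ_unique)
    then show ?thesis by simp
  qed
  with s g x0 that show ?thesis by blast
qed

end

end

section \<open>Positive-definite functions\<close>

text \<open>
  The entries \<open>(z, x)\<close> of the lists are read as point masses \<open>z\<close> at \<open>x\<close>; repeated points are allowed, so
  that masses can be added by appending lists.
\<close>

definition hermitian_form :: "('g::ab_group_add \<Rightarrow> complex) \<Rightarrow> (complex \<times> 'g) list \<Rightarrow> (complex \<times> 'g) list \<Rightarrow> complex" where
  "hermitian_form \<psi> ps qs = (\<Sum>p\<leftarrow>ps. \<Sum>q\<leftarrow>qs. fst p * cnj (fst q) * \<psi> (snd p - snd q))"

definition positive_definite :: "('g::ab_group_add \<Rightarrow> complex) \<Rightarrow> bool" where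
  "positive_definite \<psi> \<longleftrightarrow> (\<forall>ps. Im (hermitian_form \<psi> ps ps) = 0 \<and> 0 \<le> Re (hermitian_form \<psi> ps ps))"

lemma hermitian_form_append:
  "hermitian_form \<psi> (ps @ ps') (qs @ qs') =
     hermitian_form \<psi> ps qs + hermitian_form \<psi> ps qs' + hermitian_form \<psi> ps' qs + hermitian_form \<psi> ps' qs'"
  by (simp add: hermitian_form_def sum_list_addf)

lemma hermitian_form_translate:
  "hermitian_form \<psi> (map (\<lambda>p. (u * fst p, snd p + b)) ps) (map (\<lambda>p. (v * fst p, snd p + c)) qs) =
     u * cnj v * hermitian_form (\<lambda>x. \<psi> (x + b - c)) ps qs"
  by (simp add: hermitian_form_def o_def sum_list_const_mult[symmetric] algebra_simps)

lemma hermitian_form_add: "hermitian_form (\<lambda>x. \<psi> x + \<phi> x) ps qs = hermitian_form \<psi> ps qs + hermitian_form \<phi> ps qs"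
  by (simp add: hermitian_form_def sum_list_addf[symmetric] algebra_simps)

lemma hermitian_form_cmult: "hermitian_form (\<lambda>x. c * \<psi> x) ps qs = c * hermitian_form \<psi> ps qs"
  by (simp add: hermitian_form_def sum_list_const_mult[symmetric] algebra_simps)

lemma hermitian_form_tendsto:
  assumes "\<And>x. (\<lambda>n. \<psi> n x) \<longlonglongrightarrow> \<phi> x"
  shows "(\<lambda>n. hermitian_form (\<psi> n) ps qs) \<longlonglongrightarrow> hermitian_form \<phi> ps qs"
proof -
  have sum: "(\<lambda>n. \<Sum>p\<leftarrow>ps. F n p) \<longlonglongrightarrow> (\<Sum>p\<leftarrow>ps. G p)"
    if "\<And>p. (\<lambda>n. F n p) \<longlonglongrightarrow> G p" for F :: "nat \<Rightarrow> complex \<times> 'a \<Rightarrow> complex" and G ps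
    by (induction ps) (auto intro!: tendsto_add that)
  show ?thesis unfolding hermitian_form_def by (intro sum tendsto_mult tendsto_const assms)
qed

lemma positive_definite_scale:
  assumes "positive_definite \<psi>" "c \<ge> 0"
  shows "positive_definite (\<lambda>x. complex_of_real c * \<psi> x)"
  using assms by (simp add: positive_definite_def hermitian_form_cmult)

lemma positive_definite_tendsto:
  assumes lim: "\<And>x. (\<lambda>n. \<psi> n x) \<longlonglongrightarrow> \<phi> x" and pd: "\<And>n. positive_definite (\<psi> n)"
  shows "positive_definite \<phi>"
  unfolding positive_definite_def
proof (intro allI conjI)
  fix ps
  note t = hermitian_form_tendsto[of \<psi> \<phi> ps ps, OF lim]
  have "(\<lambda>n. 0) \<longlonglongrightarrow> Im (hermitian_form \<phi> ps ps)"
    using tendsto_Im[OF t] pd by (simp add: positive_definite_def)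
  then show "Im (hermitian_form \<phi> ps ps) = 0" using LIMSEQ_unique tendsto_const by blast
  show "0 \<le> Re (hermitian_form \<phi> ps ps)"
    by (rule LIMSEQ_le_const[OF tendsto_Re[OF t]]) (use pd in \<open>simp add: positive_definite_def\<close>)
qed

text \<open>
  Append to the masses \<open>ps\<close> their translate by \<open>a\<close> with weight \<open>u\<close>: half the form of \<open>\<psi>\<close> at the result is
  the form of the new function at \<open>ps\<close>. On the Fourier side, the coefficient of \<open>\<psi>\<close> at a character \<open>\<xi>\<close>
  is multiplied by the nonnegative number \<open>1 + Re (u * \<xi> a)\<close>.
\<close>

lemma positive_definite_modulate:
  assumes pd: "positive_definite \<psi>" and u: "cmod u = 1"
  shows "positive_definite (\<lambda>x. \<psi> x + (u * \<psi> (x + a) + cnj u * \<psi> (x - a)) / 2)"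
  unfolding positive_definite_def
proof
  fix ps
  let ?qs = "map (\<lambda>p. (u * fst p, snd p + a)) ps"
  have uu: "u * cnj u = 1" using u complex_norm_square[of u] by simp
  have id: "map (\<lambda>p. (1 * fst p, snd p + 0)) ps = ps" by simp
  have 1: "hermitian_form \<psi> ps ?qs = cnj u * hermitian_form (\<lambda>x. \<psi> (x - a)) ps ps"
    using hermitian_form_translate[of \<psi> 1 0 ps u a ps] by simp
  have 2: "hermitian_form \<psi> ?qs ps = u * hermitian_form (\<lambda>x. \<psi> (x + a)) ps ps"
    using hermitian_form_translate[of \<psi> u a ps 1 0 ps] by simp
  have 3: "hermitian_form \<psi> ?qs ?qs = hermitian_form \<psi> ps ps"
    using hermitian_form_translate[of \<psi> u a ps u a ps] by (simp add: uu)
  have "hermitian_form (\<lambda>x. \<psi> x + (u * \<psi> (x + a) + cnj u * \<psi> (x - a)) / 2) ps ps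
      = hermitian_form (\<lambda>x. \<psi> x + (u / 2 * \<psi> (x + a) + cnj u / 2 * \<psi> (x - a))) ps ps"
    by (simp add: add_divide_distrib)
  also have "\<dots> = hermitian_form \<psi> (ps @ ?qs) (ps @ ?qs) / 2"
    unfolding hermitian_form_append 1 2 3 by (simp only: hermitian_form_add hermitian_form_cmult) (simp add: field_simps)
  finally have eq: "hermitian_form (\<lambda>x. \<psi> x + (u * \<psi> (x + a) + cnj u * \<psi> (x - a)) / 2) ps ps
      = hermitian_form \<psi> (ps @ ?qs) (ps @ ?qs) / 2" .
  show "Im (hermitian_form (\<lambda>x. \<psi> x + (u * \<psi> (x + a) + cnj u * \<psi> (x - a)) / 2) ps ps) = 0 \<and>
      0 \<le> Re (hermitian_form (\<lambda>x. \<psi> x + (u * \<psi> (x + a) + cnj u * \<psi> (x - a)) / 2) ps ps)"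
    unfolding eq using pd[unfolded positive_definite_def, rule_format, of "ps @ ?qs"] by simp
qed

lemma positive_definite_uminus_arg:
  assumes pd: "positive_definite \<psi>"
  shows "\<psi> (- x) = cnj (\<psi> x)"
proof (rule complex_eqI)
  have form: "hermitian_form \<psi> [(1, x), (z, 0)] [(1, x), (z, 0)]
      = \<psi> 0 + cnj z * \<psi> x + z * \<psi> (- x) + z * cnj z * \<psi> 0" for z
    by (simp add: hermitian_form_def algebra_simps)
  have Im0: "Im (\<psi> 0) = 0"
    using pd[unfolded positive_definite_def, rule_format, of "[(1, 0)]"] by (simp add: hermitian_form_def)
  have Im: "Im (\<psi> 0 + cnj z * \<psi> x + z * \<psi> (- x) + z * cnj z * \<psi> 0) = 0" for z
    using pd unfolding positive_definite_def form[symmetric] by blast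
  show "Im (\<psi> (- x)) = Im (cnj (\<psi> x))" using Im[of 1] Im0 by simp
  show "Re (\<psi> (- x)) = Re (cnj (\<psi> x))" using Im[of \<i>] Im0 by simp
qed

text \<open>
  Evaluate the form at two points, with weights 1 and \<open>z\<close>, where the unimodular number \<open>z\<close> makes the
  mixed terms as negative as possible.
\<close>

lemma positive_definite_cmod_le:
  assumes pd: "positive_definite \<psi>"
  shows "cmod (\<psi> x) \<le> Re (\<psi> 0)"
proof (cases "\<psi> x = 0")
  case True
  then show ?thesis
    using pd[unfolded positive_definite_def, rule_format, of "[(1, 0)]"] by (simp add: hermitian_form_def)
next
  case False
  define z where "z = - (\<psi> x / cmod (\<psi> x))"
  have "cmod z = 1" using False by (simp add: z_def norm_divide)
  then have zz: "z * cnj z = 1" using complex_norm_square[of z] by simp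
  have zc: "z * cnj (\<psi> x) = - of_real (cmod (\<psi> x))"
    using False complex_norm_square[of "\<psi> x"] by (simp add: z_def power2_eq_square divide_eq_eq)
  then have "cnj (z * cnj (\<psi> x)) = - of_real (cmod (\<psi> x))" by simp
  then have zc': "cnj z * \<psi> x = - of_real (cmod (\<psi> x))" by simp
  have "hermitian_form \<psi> [(1, x), (z, 0)] [(1, x), (z, 0)]
      = \<psi> 0 + cnj z * \<psi> x + z * \<psi> (- x) + z * cnj z * \<psi> 0"
    by (simp add: hermitian_form_def algebra_simps)
  also have "\<dots> = 2 * \<psi> 0 - 2 * of_real (cmod (\<psi> x))"
    unfolding positive_definite_uminus_arg[OF pd] zz zc zc' by simp
  finally have "Re (2 * \<psi> 0 - 2 * of_real (cmod (\<psi> x))) \<ge> 0"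
    using pd unfolding positive_definite_def by metis
  then show ?thesis by simp
qed

text \<open>
  For real functions, this is the convolution of \<open>f\<close> with the reflection of \<open>h\<close>.
\<close>

definition correlate :: "('g::ab_group_add \<Rightarrow> real) \<Rightarrow> ('g \<Rightarrow> real) \<Rightarrow> 'g \<Rightarrow> real" where
  "correlate f h x = mean (\<lambda>y. f (x + y) * h y)"

context
  assumes compact_UNIV: "compact (UNIV :: 'g::topological_ab_group_add set)"
begin

lemma continuous_on_correlate_integrand:
  assumes f: "continuous_on UNIV (f :: 'g \<Rightarrow> real)" and h: "continuous_on UNIV h"
  shows "continuous_on UNIV (\<lambda>p. f (fst p + snd p) * h (snd p))"
    and "continuous_on UNIV (\<lambda>y. f (x + y) * h y)"
  by (intro continuous_intros continuous_on_compose_UNIV[OF f] continuous_on_compose_UNIV[OF h])+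

lemma continuous_on_correlate:
  assumes f: "continuous_on UNIV (f :: 'g \<Rightarrow> real)" and h: "continuous_on UNIV h"
  shows "continuous_on UNIV (correlate f h)"
  unfolding correlate_def[abs_def]
  by (rule continuous_on_mean[OF compact_UNIV continuous_on_correlate_integrand(1)[OF f h]])

lemma correlate_diff_arg:
  assumes f: "continuous_on UNIV (f :: 'g \<Rightarrow> real)" and h: "continuous_on UNIV h"
  shows "correlate f h (x - y) = mean (\<lambda>t. f (x + t) * h (y + t))"
  using mean_shift[OF compact_UNIV continuous_on_correlate_integrand(2)[OF f h], of "x - y" y]
  by (simp add: correlate_def algebra_simps)

lemma convolve_correlate:
  assumes K: "continuous_on UNIV (K :: 'g \<Rightarrow> real)" and f: "continuous_on UNIV f" and h: "continuous_on UNIV h"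
  shows "convolve K (correlate f h) x = correlate (convolve K f) h x"
proof -
  have "convolve K (correlate f h) x = mean (\<lambda>z. mean (\<lambda>y. K (x - z) * (f (z + y) * h y)))"
    using mean_cmult[OF compact_UNIV continuous_on_correlate_integrand(2)[OF f h]]
    by (simp add: convolve_def correlate_def)
  also have "\<dots> = mean (\<lambda>y. mean (\<lambda>z. K (x - z) * (f (z + y) * h y)))"
    by (rule mean_swap[OF compact_UNIV])
      (intro continuous_intros continuous_on_compose_UNIV[OF K] continuous_on_compose_UNIV[OF f] continuous_on_compose_UNIV[OF h])
  also have "\<dots> = mean (\<lambda>y. convolve K f (x + y) * h y)"
  proof -
    have "mean (\<lambda>z. K (x - z) * (f (z + y) * h y)) = convolve K f (x + y) * h y" for y
    proof -
      have fy: "continuous_on UNIV (\<lambda>z. f (z + y))"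
        by (intro continuous_intros continuous_on_compose_UNIV[OF f])
      have "mean (\<lambda>z. K (x - z) * (f (z + y) * h y)) = mean (\<lambda>z. h y * (K (x - z) * f (z + y)))"
        by (simp add: mult_ac)
      also have "\<dots> = h y * convolve K (\<lambda>z. f (z + y)) x"
        unfolding convolve_def
        by (rule mean_cmult[OF compact_UNIV continuous_on_convolve_integrand(2)[OF compact_UNIV K fy]])
      also have "\<dots> = convolve K f (x + y) * h y"
        using convolve_shift[OF compact_UNIV K f] by simp
      finally show ?thesis .
    qed
    then show ?thesis by simp
  qed
  finally show ?thesis by (simp add: correlate_def)
qed

lemma mean_sum_list_product:
  assumes F: "\<And>p. continuous_on UNIV (F p :: 'g \<Rightarrow> real)"
  shows "(\<Sum>p\<leftarrow>ps. \<Sum>q\<leftarrow>qs. a p * b q * mean (\<lambda>t. F p t * F q t)) =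
    mean (\<lambda>t. (\<Sum>p\<leftarrow>ps. a p * F p t) * (\<Sum>q\<leftarrow>qs. b q * F q t))"
proof -
  have cs: "continuous_on UNIV (\<lambda>t. \<Sum>q\<leftarrow>qs. c q * F q t)" for qs c
    by (induction qs) (auto intro!: continuous_intros F)
  have "mean (\<lambda>t. (\<Sum>p\<leftarrow>ps. a p * F p t) * (\<Sum>q\<leftarrow>qs. b q * F q t)) =
      mean (\<lambda>t. \<Sum>p\<leftarrow>ps. a p * F p t * (\<Sum>q\<leftarrow>qs. b q * F q t))"
    by (simp add: sum_list_mult_const)
  also have "\<dots> = (\<Sum>p\<leftarrow>ps. mean (\<lambda>t. a p * F p t * (\<Sum>q\<leftarrow>qs. b q * F q t)))"
    by (rule mean_sum_list[OF compact_UNIV, of "\<lambda>p t. a p * F p t * (\<Sum>q\<leftarrow>qs. b q * F q t)"])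
      (intro continuous_intros F cs)
  also have "(\<lambda>p. mean (\<lambda>t. a p * F p t * (\<Sum>q\<leftarrow>qs. b q * F q t)))
      = (\<lambda>p. \<Sum>q\<leftarrow>qs. a p * b q * mean (\<lambda>t. F p t * F q t))"
  proof
    fix p
    have "mean (\<lambda>t. a p * F p t * (\<Sum>q\<leftarrow>qs. b q * F q t))
        = mean (\<lambda>t. \<Sum>q\<leftarrow>qs. a p * b q * (F p t * F q t))"
      by (simp add: sum_list_const_mult[symmetric] mult_ac)
    also have "\<dots> = (\<Sum>q\<leftarrow>qs. mean (\<lambda>t. a p * b q * (F p t * F q t)))"
      by (rule mean_sum_list[OF compact_UNIV, of "\<lambda>q t. a p * b q * (F p t * F q t)"])
        (intro continuous_intros F)
    also have "(\<lambda>q. mean (\<lambda>t. a p * b q * (F p t * F q t))) = (\<lambda>q. a p * b q * mean (\<lambda>t. F p t * F q t))"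
      by (intro ext mean_cmult[OF compact_UNIV] continuous_intros F)
    finally show "mean (\<lambda>t. a p * F p t * (\<Sum>q\<leftarrow>qs. b q * F q t))
      = (\<Sum>q\<leftarrow>qs. a p * b q * mean (\<lambda>t. F p t * F q t))" .
  qed
  finally show ?thesis by simp
qed

text \<open>
  The form at a list of masses \<open>z\<close> at points \<open>x\<close> is the mean of the squared modulus of the sum of the
  functions \<open>\<lambda>t. z * f (x + t)\<close>. The proof computes its real and imaginary parts, because the mean is
  defined for real functions only.
\<close>

lemma positive_definite_autocorrelation:
  assumes f: "continuous_on UNIV (f :: 'g \<Rightarrow> real)"
  shows "positive_definite (\<lambda>x. complex_of_real (correlate f f x))"
  unfolding positive_definite_def
proof
  fix ps :: "(complex \<times> 'g) list"
  define F where "F p t = f (snd p + t)" for p :: "complex \<times> 'g" and t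
  have F: "continuous_on UNIV (F p)" for p
    unfolding F_def by (intro continuous_intros continuous_on_compose_UNIV[OF f])
  have Re_sum: "Re (\<Sum>p\<leftarrow>ps. G p) = (\<Sum>p\<leftarrow>ps. Re (G p))"
    and Im_sum: "Im (\<Sum>p\<leftarrow>ps. G p) = (\<Sum>p\<leftarrow>ps. Im (G p))" for G :: "complex \<times> 'g \<Rightarrow> complex" and ps
    by (induction ps) auto
  define A B where "A t = (\<Sum>p\<leftarrow>ps. Re (fst p) * F p t)" and "B t = (\<Sum>p\<leftarrow>ps. Im (fst p) * F p t)" for t
  have cont: "continuous_on UNIV (\<lambda>t. \<Sum>p\<leftarrow>ps. c p * F p t)" for c :: "complex \<times> 'g \<Rightarrow> real" and ps
    by (induction ps) (auto intro!: continuous_intros F)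
  have corr: "correlate f f (snd p - snd q) = mean (\<lambda>t. F p t * F q t)" for p q :: "complex \<times> 'g"
    unfolding F_def by (rule correlate_diff_arg[OF f f])
  have neg: "(\<Sum>q\<leftarrow>ps. - (Im (fst q) * F q t)) = - (\<Sum>q\<leftarrow>ps. Im (fst q) * F q t)" for ps t
    by (induction ps) auto
  note L = mean_sum_list_product[of F, OF F, symmetric]
  have "Im (hermitian_form (\<lambda>x. complex_of_real (correlate f f x)) ps ps)
      = (\<Sum>p\<leftarrow>ps. \<Sum>q\<leftarrow>ps. Im (fst p) * Re (fst q) * mean (\<lambda>t. F p t * F q t))
      + (\<Sum>p\<leftarrow>ps. \<Sum>q\<leftarrow>ps. Re (fst p) * (- Im (fst q)) * mean (\<lambda>t. F p t * F q t))"
    unfolding hermitian_form_def Im_sum corr sum_list_addf[symmetric] by (simp add: algebra_simps)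
  also have "\<dots> = mean (\<lambda>t. B t * A t) + mean (\<lambda>t. A t * (\<Sum>q\<leftarrow>ps. - Im (fst q) * F q t))"
    unfolding A_def B_def L ..
  also have "(\<lambda>t. A t * (\<Sum>q\<leftarrow>ps. - Im (fst q) * F q t)) = (\<lambda>t. - 1 * (B t * A t))"
    by (simp add: fun_eq_iff B_def neg)
  also have "mean (\<lambda>t. - 1 * (B t * A t)) = - 1 * mean (\<lambda>t. B t * A t)"
    unfolding A_def B_def by (intro mean_cmult[OF compact_UNIV] continuous_intros cont)
  finally have Im: "Im (hermitian_form (\<lambda>x. complex_of_real (correlate f f x)) ps ps) = 0" by simp
  have "Re (hermitian_form (\<lambda>x. complex_of_real (correlate f f x)) ps ps)
      = (\<Sum>p\<leftarrow>ps. \<Sum>q\<leftarrow>ps. Re (fst p) * Re (fst q) * mean (\<lambda>t. F p t * F q t))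
      + (\<Sum>p\<leftarrow>ps. \<Sum>q\<leftarrow>ps. Im (fst p) * Im (fst q) * mean (\<lambda>t. F p t * F q t))"
    unfolding hermitian_form_def Re_sum corr sum_list_addf[symmetric] by (simp add: algebra_simps)
  also have "\<dots> = mean (\<lambda>t. A t * A t) + mean (\<lambda>t. B t * B t)"
    unfolding A_def B_def L ..
  also have "\<dots> \<ge> 0"
    unfolding A_def B_def
    by (intro add_nonneg_nonneg mean_ge[OF compact_UNIV] continuous_intros cont) auto
  finally show "Im (hermitian_form (\<lambda>x. complex_of_real (correlate f f x)) ps ps) = 0 \<and>
      0 \<le> Re (hermitian_form (\<lambda>x. complex_of_real (correlate f f x)) ps ps)" using Im by simp
qed

end

section \<open>Extremal positive-definite eigenfunctions\<close>

definition square_eigenspace :: "('g::topological_ab_group_add \<Rightarrow> real) \<Rightarrow> real \<Rightarrow> ('g \<Rightarrow> real) set" where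
  "square_eigenspace K s = {f. continuous_on UNIV f \<and> (\<forall>x. convolve K (convolve K f) x = s * f x)}"

definition pd_eigenfunctions :: "('g::topological_ab_group_add \<Rightarrow> real) \<Rightarrow> real \<Rightarrow> ('g \<Rightarrow> complex) set" where
  "pd_eigenfunctions K s = {\<psi>. positive_definite \<psi> \<and>
     (\<lambda>x. Re (\<psi> x)) \<in> square_eigenspace K s \<and> (\<lambda>x. Im (\<psi> x)) \<in> square_eigenspace K s}"

lemma pd_eigenfunctions_continuous:
  assumes "\<psi> \<in> pd_eigenfunctions K s"
  shows "continuous_on UNIV \<psi>"
proof -
  have "continuous_on UNIV (\<lambda>x. Re (\<psi> x))" "continuous_on UNIV (\<lambda>x. Im (\<psi> x))"
    using assms by (auto simp: pd_eigenfunctions_def square_eigenspace_def)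
  then have "continuous_on UNIV (\<lambda>x. complex_of_real (Re (\<psi> x)) + \<i> * complex_of_real (Im (\<psi> x)))"
    by (intro continuous_on_add continuous_on_mult continuous_on_const continuous_on_of_real)
  then show ?thesis by (simp flip: complex_eq)
qed

context
  fixes K :: "'g::topological_ab_group_add \<Rightarrow> real" and s :: real
  assumes compact_UNIV: "compact (UNIV :: 'g set)"
    and K: "continuous_on UNIV K" and s: "s > 0"
begin

lemma square_eigenspace_linear:
  assumes f: "f \<in> square_eigenspace K s" and g: "g \<in> square_eigenspace K s"
  shows "(\<lambda>x. a * f x + b * g x) \<in> square_eigenspace K s"
proof -
  have cf: "continuous_on UNIV f" and cg: "continuous_on UNIV g"
    using f g by (auto simp: square_eigenspace_def)
  have lin: "convolve K (\<lambda>x. a * f x + b * g x) = (\<lambda>x. a * convolve K f x + b * convolve K g x)"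
    if cf: "continuous_on UNIV f" and cg: "continuous_on UNIV g" for f g
    using convolve_add[OF compact_UNIV K continuous_on_mult_left[OF cf] continuous_on_mult_left[OF cg]]
      convolve_cmult[OF compact_UNIV K cf] convolve_cmult[OF compact_UNIV K cg]
    by (simp add: fun_eq_iff)
  have "convolve K (convolve K (\<lambda>x. a * f x + b * g x)) x = s * (a * f x + b * g x)" for x
    unfolding lin[OF cf cg] lin[OF continuous_on_convolve[OF compact_UNIV K cf] continuous_on_convolve[OF compact_UNIV K cg]]
    using f g by (simp add: square_eigenspace_def algebra_simps)
  moreover have "continuous_on UNIV (\<lambda>x. a * f x + b * g x)" by (intro continuous_intros cf cg)
  ultimately show ?thesis by (simp add: square_eigenspace_def)
qed

lemma square_eigenspace_shift:
  assumes f: "f \<in> square_eigenspace K s"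
  shows "(\<lambda>x. f (x + a)) \<in> square_eigenspace K s"
proof -
  have cf: "continuous_on UNIV f" using f by (auto simp: square_eigenspace_def)
  have sh: "convolve K (\<lambda>x. f (x + a)) = (\<lambda>x. convolve K f (x + a))" if "continuous_on UNIV f" for f
    using convolve_shift[OF compact_UNIV K that] by (simp add: fun_eq_iff)
  have "convolve K (convolve K (\<lambda>x. f (x + a))) x = s * f (x + a)" for x
    unfolding sh[OF cf] sh[OF continuous_on_convolve[OF compact_UNIV K cf]]
    using f by (simp add: square_eigenspace_def)
  moreover have "continuous_on UNIV (\<lambda>x. f (x + a))"
    by (intro continuous_intros continuous_on_compose_UNIV[OF cf])
  ultimately show ?thesis by (simp add: square_eigenspace_def)
qed

lemma square_eigenspace_uniform_limit:
  assumes f: "\<And>n. f n \<in> square_eigenspace K s" and lim: "uniform_limit UNIV f g sequentially"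
  shows "g \<in> square_eigenspace K s"
proof -
  have cf: "continuous_on UNIV (f n)" for n using f by (auto simp: square_eigenspace_def)
  note cc = continuous_on_convolve[OF compact_UNIV K]
  have cg: "continuous_on UNIV g" by (rule uniform_limit_theorem[OF _ lim]) (auto simp: cf)
  note lim2 = convolve_uniform_limit[OF compact_UNIV K convolve_uniform_limit[OF compact_UNIV K lim cf] cc[OF cf]]
  have "convolve K (convolve K g) x = s * g x" for x
  proof (rule LIMSEQ_unique)
    show "(\<lambda>n. convolve K (convolve K (f n)) x) \<longlonglongrightarrow> convolve K (convolve K g) x"
      by (rule tendsto_uniform_limitI[OF lim2 UNIV_I])
    have "(\<lambda>n. s * f n x) \<longlonglongrightarrow> s * g x"
      by (intro tendsto_intros tendsto_uniform_limitI[OF lim UNIV_I])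
    then show "(\<lambda>n. convolve K (convolve K (f n)) x) \<longlonglongrightarrow> s * g x"
      using f by (simp add: square_eigenspace_def)
  qed
  with cg show ?thesis by (simp add: square_eigenspace_def)
qed

text \<open>
  An eigenfunction \<open>f\<close> is the convolution of \<open>K\<close> with a multiple of \<open>convolve K f\<close>, hence its continuity
  is controlled by that of \<open>K\<close> alone, uniformly over all \<open>f\<close> that are bounded by 1.
\<close>

lemma square_eigenspace_equicontinuous:
  assumes e: "e > 0"
  shows "\<exists>U. open U \<and> x \<in> U \<and>
    (\<forall>y\<in>U. \<forall>f\<in>square_eigenspace K s. (\<forall>z. \<bar>f z\<bar> \<le> 1) \<longrightarrow> \<bar>f y - f x\<bar> \<le> e)"
proof -
  obtain B where B: "B > 0" "\<And>x. \<bar>K x\<bar> \<le> B"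
    using continuous_on_compact_UNIV_bounded[OF compact_UNIV K] by (metis real_norm_def)
  have "e * s / B > 0" using e s B(1) by simp
  from convolve_equicontinuous[OF compact_UNIV K this, of x] obtain U where U: "open U" "x \<in> U"
    "\<And>y h. y \<in> U \<Longrightarrow> continuous_on UNIV h \<Longrightarrow> mean (\<lambda>x. (h x)\<^sup>2) \<le> 1 \<Longrightarrow>
      \<bar>convolve K h y - convolve K h x\<bar> \<le> e * s / B"
    by blast
  have "\<bar>f y - f x\<bar> \<le> e" if y: "y \<in> U" and f: "f \<in> square_eigenspace K s" and f1: "\<And>z. \<bar>f z\<bar> \<le> 1" for y f
  proof -
    have cf: "continuous_on UNIV f" using f by (auto simp: square_eigenspace_def)
    note ch = continuous_on_convolve[OF compact_UNIV K cf]
    define h where "h = (\<lambda>x. inverse B * convolve K f x)"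
    have hc: "continuous_on UNIV h" unfolding h_def by (intro continuous_intros ch)
    have "\<bar>h z\<bar> \<le> 1" for z
      using convolve_abs_le[OF compact_UNIV K cf B(2) f1, of z] B(1) by (simp add: h_def abs_mult field_simps)
    then have "mean (\<lambda>x. (h x)\<^sup>2) \<le> mean (\<lambda>_::'g. 1)"
      by (intro mean_mono[OF compact_UNIV] continuous_intros hc) (simp add: abs_square_le_1)
    then have "mean (\<lambda>x. (h x)\<^sup>2) \<le> 1" by (simp add: mean_const[OF compact_UNIV])
    from U(3)[OF y hc this] have le: "\<bar>convolve K h y - convolve K h x\<bar> \<le> e * s / B" .
    have "convolve K h z = inverse B * (s * f z)" for z
      using convolve_cmult[OF compact_UNIV K ch] f by (simp add: h_def square_eigenspace_def)
    then have "convolve K h y - convolve K h x = (s / B) * (f y - f x)"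
      by (simp add: divide_inverse algebra_simps)
    then have "(s / B) * \<bar>f y - f x\<bar> \<le> (s / B) * e" using le s B(1) by (simp add: abs_mult mult.commute)
    then show ?thesis using s B(1) by (simp add: divide_le_cancel mult_le_cancel_left)
  qed
  with U(1,2) show ?thesis by blast
qed

lemma pd_eigenfunctions_scale:
  assumes "\<psi> \<in> pd_eigenfunctions K s" "c \<ge> 0"
  shows "(\<lambda>x. complex_of_real c * \<psi> x) \<in> pd_eigenfunctions K s"
  using assms square_eigenspace_linear[of "\<lambda>x. Re (\<psi> x)" "\<lambda>x. Re (\<psi> x)" c 0]
    square_eigenspace_linear[of "\<lambda>x. Im (\<psi> x)" "\<lambda>x. Im (\<psi> x)" c 0]
  by (simp add: pd_eigenfunctions_def positive_definite_scale)

lemma pd_eigenfunctions_modulate: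
  assumes \<psi>: "\<psi> \<in> pd_eigenfunctions K s" and u: "cmod u = 1"
  shows "(\<lambda>x. \<psi> x + (u * \<psi> (x + a) + cnj u * \<psi> (x - a)) / 2) \<in> pd_eigenfunctions K s"
proof -
  note lin = square_eigenspace_linear and shift = square_eigenspace_shift
  have R: "(\<lambda>x. Re (\<psi> x)) \<in> square_eigenspace K s" and I: "(\<lambda>x. Im (\<psi> x)) \<in> square_eigenspace K s"
    using \<psi> by (auto simp: pd_eigenfunctions_def)
  have "(\<lambda>x. 1 * Re (\<psi> x) + (1/2) * (1 * (Re u * Re (\<psi> (x + a)) + (- Im u) * Im (\<psi> (x + a)))
      + 1 * (Re u * Re (\<psi> (x + (- a))) + Im u * Im (\<psi> (x + (- a)))))) \<in> square_eigenspace K s"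
    by (intro lin R shift[OF R] shift[OF I])
  moreover have "(\<lambda>x. 1 * Im (\<psi> x) + (1/2) * (1 * (Re u * Im (\<psi> (x + a)) + Im u * Re (\<psi> (x + a)))
      + 1 * (Re u * Im (\<psi> (x + (- a))) + (- Im u) * Re (\<psi> (x + (- a)))))) \<in> square_eigenspace K s"
    by (intro lin I shift[OF R] shift[OF I])
  moreover have "positive_definite \<psi>" using \<psi> by (simp add: pd_eigenfunctions_def)
  ultimately show ?thesis
    using positive_definite_modulate[OF _ u, of \<psi> a]
    by (simp add: pd_eigenfunctions_def field_simps)
qed

text \<open>
  The positive-definite eigenfunctions with value 1 at 0 are bounded by 1 and equicontinuous, and they
  form a closed set in the uniform topology. So the mean square attains its maximum on them.
\<close>

lemma pd_eigenfunctions_maximiser: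
  assumes nonempty: "\<psi>\<^sub>0 \<in> pd_eigenfunctions K s" "\<psi>\<^sub>0 0 = 1"
  obtains \<psi> where "\<psi> \<in> pd_eigenfunctions K s" "\<psi> 0 = 1"
    "\<And>\<phi>. \<phi> \<in> pd_eigenfunctions K s \<Longrightarrow> \<phi> 0 = 1 \<Longrightarrow>
      mean (\<lambda>x. (cmod (\<phi> x))\<^sup>2) \<le> mean (\<lambda>x. (cmod (\<psi> x))\<^sup>2)"
proof -
  define J where "J \<psi> = mean (\<lambda>x. (cmod (\<psi> x))\<^sup>2)" for \<psi> :: "'g \<Rightarrow> complex"
  define E where "E = {\<psi> \<in> pd_eigenfunctions K s. \<psi> 0 = 1}"
  have pd: "positive_definite \<psi>" if "\<psi> \<in> E" for \<psi> using that by (simp add: E_def pd_eigenfunctions_def)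
  have le1: "cmod (\<psi> x) \<le> 1" if "\<psi> \<in> E" for \<psi> x
    using positive_definite_cmod_le[OF pd[OF that], of x] that by (simp add: E_def)
  have cont: "continuous_on UNIV \<psi>" if "\<psi> \<in> E" for \<psi>
    using that pd_eigenfunctions_continuous unfolding E_def by blast
  have J1: "J \<psi> \<le> 1" if "\<psi> \<in> E" for \<psi>
  proof -
    have "J \<psi> \<le> mean (\<lambda>_::'g. 1)"
      unfolding J_def
      by (intro mean_mono[OF compact_UNIV] continuous_intros cont[OF that])
        (simp add: abs_square_le_1 le1[OF that])
    then show ?thesis by (simp add: mean_const[OF compact_UNIV])
  qed
  have bdd: "bdd_above (J ` E)" using J1 by (intro bdd_aboveI[of _ 1]) auto
  have ne: "J ` E \<noteq> {}" using nonempty by (auto simp: E_def)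
  define j where "j = Sup (J ` E)"
  have ex: "\<exists>\<psi>. \<psi> \<in> E \<and> j - inverse (real (Suc n)) < J \<psi>" for n
  proof -
    have "j - inverse (real (Suc n)) < j" by simp
    then obtain c where "c \<in> J ` E" "j - inverse (real (Suc n)) < c"
      using less_cSup_iff[OF ne bdd] unfolding j_def by blast
    then show ?thesis by blast
  qed
  obtain \<psi> where "\<forall>n. \<psi> n \<in> E \<and> j - inverse (real (Suc n)) < J (\<psi> n)"
    using choice[OF allI[OF ex]] ..
  then have \<psi>: "\<psi> n \<in> E" "j - inverse (real (Suc n)) < J (\<psi> n)" for n by simp_all
  have eig: "(\<lambda>x. Re (\<psi> n x)) \<in> square_eigenspace K s" "(\<lambda>x. Im (\<psi> n x)) \<in> square_eigenspace K s" for n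
    using \<psi>(1)[of n] by (simp_all add: E_def pd_eigenfunctions_def)
  have equi: "\<exists>U. open U \<and> x \<in> U \<and> (\<forall>y\<in>U. \<forall>n. dist (\<psi> n y) (\<psi> n x) \<le> e)" if e: "e > 0" for x e
  proof -
    obtain U where U: "open U" "x \<in> U"
      "\<And>y f. y \<in> U \<Longrightarrow> f \<in> square_eigenspace K s \<Longrightarrow> (\<And>z. \<bar>f z\<bar> \<le> 1) \<Longrightarrow> \<bar>f y - f x\<bar> \<le> e / 2"
      using square_eigenspace_equicontinuous[OF half_gt_zero[OF e], of x] by blast
    have "dist (\<psi> n y) (\<psi> n x) \<le> e" if y: "y \<in> U" for n y
    proof -
      have "\<bar>Re (\<psi> n y) - Re (\<psi> n x)\<bar> \<le> e / 2"
        by (rule U(3)[OF y eig(1)]) (rule order_trans[OF abs_Re_le_cmod le1[OF \<psi>(1)]])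
      moreover have "\<bar>Im (\<psi> n y) - Im (\<psi> n x)\<bar> \<le> e / 2"
        by (rule U(3)[OF y eig(2)]) (rule order_trans[OF abs_Im_le_cmod le1[OF \<psi>(1)]])
      ultimately show ?thesis
        using cmod_le[of "\<psi> n y - \<psi> n x"] by (simp add: dist_norm)
    qed
    with U(1,2) show ?thesis by blast
  qed
  obtain \<phi> r where r: "strict_mono (r :: nat \<Rightarrow> nat)" and \<phi>: "continuous_on UNIV \<phi>"
    and lim: "uniform_limit UNIV (\<lambda>n. \<psi> (r n)) \<phi> sequentially"
    by (rule arzela_ascoli_subsequence[of \<psi>, OF compact_UNIV le1[OF \<psi>(1)] equi]) (assumption | rule that)+
  have plim: "(\<lambda>n. \<psi> (r n) x) \<longlonglongrightarrow> \<phi> x" for x by (rule tendsto_uniform_limitI[OF lim UNIV_I])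
  have "positive_definite \<phi>" by (rule positive_definite_tendsto[OF plim pd[OF \<psi>(1)]])
  moreover have "(\<lambda>x. Re (\<phi> x)) \<in> square_eigenspace K s"
    by (rule square_eigenspace_uniform_limit[OF eig(1) bounded_linear.uniform_limit[OF bounded_linear_Re lim]])
  moreover have "(\<lambda>x. Im (\<phi> x)) \<in> square_eigenspace K s"
    by (rule square_eigenspace_uniform_limit[OF eig(2) bounded_linear.uniform_limit[OF bounded_linear_Im lim]])
  moreover have \<phi>0: "\<phi> 0 = 1"
  proof (rule LIMSEQ_unique[OF plim])
    show "(\<lambda>n. \<psi> (r n) 0) \<longlonglongrightarrow> 1" using \<psi>(1) by (simp add: E_def)
  qed
  ultimately have \<phi>P: "\<phi> \<in> pd_eigenfunctions K s" by (simp add: pd_eigenfunctions_def)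
  have inv0: "(\<lambda>n. inverse (real (Suc (r n)))) \<longlonglongrightarrow> 0"
    using LIMSEQ_subseq_LIMSEQ[OF LIMSEQ_inverse_real_of_nat r] by (simp add: o_def)
  have lim_j: "(\<lambda>n. j - inverse (real (Suc (r n)))) \<longlonglongrightarrow> j"
    using tendsto_diff[OF tendsto_const inv0, of j] by simp
  obtain C where "\<And>x. cmod (\<phi> x) \<le> C"
    using continuous_on_compact_UNIV_bounded[OF compact_UNIV \<phi>] by metis
  then have b: "bounded (range (\<lambda>x. cmod (\<phi> x)))"
    by (intro boundedI[of _ C]) auto
  have limc: "uniform_limit UNIV (\<lambda>n x. cmod (\<psi> (r n) x)) (\<lambda>x. cmod (\<phi> x)) sequentially"
    by (rule uniform_limit_norm[OF lim])
  have lim_J: "(\<lambda>n. J (\<psi> (r n))) \<longlonglongrightarrow> J \<phi>"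
    unfolding J_def power2_eq_square
    by (rule mean_uniform_limit[OF compact_UNIV uniform_lim_mult[OF limc limc b b]])
      (intro continuous_intros cont \<psi>)
  have "j \<le> J \<phi>" by (rule LIMSEQ_le[OF lim_j lim_J]) (use \<psi>(2) less_imp_le in blast)
  moreover have "J \<eta> \<le> j" if "\<eta> \<in> E" for \<eta> unfolding j_def using that bdd by (intro cSup_upper) auto
  ultimately have "J \<eta> \<le> J \<phi>" if "\<eta> \<in> pd_eigenfunctions K s" "\<eta> 0 = 1" for \<eta>
    using that unfolding E_def by fastforce
  with \<phi>P \<phi>0 that show ?thesis unfolding J_def by blast
qed

text \<open>
  A maximiser of a strictly convex functional on a convex set is an extreme point, and extreme points
  are characters. In detail, the modulations \<open>\<theta> u\<close> and \<open>\<theta> (- u)\<close> of \<open>\<psi>\<close> are positive-definite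
  eigenfunctions with sum \<open>2 * \<psi>\<close>, so by extremality both are multiples of \<open>\<psi>\<close>, and the factor is the
  value at 0. The choices \<open>u = 1\<close> and \<open>u = \<i>\<close> determine \<open>\<psi> (x + a) + \<psi> (x - a)\<close> and
  \<open>\<psi> (x + a) - \<psi> (x - a)\<close>, hence \<open>\<psi> (x + a)\<close>.
\<close>

lemma pd_eigenfunctions_maximiser_multiplicative:
  assumes \<psi>: "\<psi> \<in> pd_eigenfunctions K s" "\<psi> 0 = 1"
    and max: "\<And>\<phi>. \<phi> \<in> pd_eigenfunctions K s \<Longrightarrow> \<phi> 0 = 1 \<Longrightarrow>
      mean (\<lambda>x. (cmod (\<phi> x))\<^sup>2) \<le> mean (\<lambda>x. (cmod (\<psi> x))\<^sup>2)"
  shows "\<psi> (x + a) = \<psi> a * \<psi> x"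
proof -
  define J where "J \<psi> = mean (\<lambda>x. (cmod (\<psi> x))\<^sup>2)" for \<psi> :: "'g \<Rightarrow> complex"
  have pd: "positive_definite \<phi>" if "\<phi> \<in> pd_eigenfunctions K s" for \<phi>
    using that by (simp add: pd_eigenfunctions_def)
  note cont = pd_eigenfunctions_continuous
  \<comment> \<open>The homogeneous form of maximality also covers functions that vanish at 0, which cannot be normalised.\<close>
  have J_le: "J \<phi> \<le> t\<^sup>2 * J \<psi>" if \<phi>: "\<phi> \<in> pd_eigenfunctions K s" "\<phi> 0 = complex_of_real t" for \<phi> t
  proof (cases "t = 0")
    case True
    then have "\<phi> x = 0" for x using positive_definite_cmod_le[OF pd[OF \<phi>(1)], of x] \<phi>(2) by simp
    then show ?thesis using True by (simp add: J_def mean_const[OF compact_UNIV])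
  next
    case False
    have "0 \<le> t" using order_trans[OF norm_ge_zero positive_definite_cmod_le[OF pd[OF \<phi>(1)], of 0]] \<phi>(2) by simp
    with False have t: "t > 0" by simp
    have "(\<lambda>x. complex_of_real (inverse t) * \<phi> x) \<in> pd_eigenfunctions K s"
      using t by (intro pd_eigenfunctions_scale \<phi>) simp
    moreover have "complex_of_real (inverse t) * \<phi> 0 = 1" using \<phi>(2) t by simp
    ultimately have "J (\<lambda>x. complex_of_real (inverse t) * \<phi> x) \<le> J \<psi>" unfolding J_def by (rule max)
    moreover have "J (\<lambda>x. complex_of_real (inverse t) * \<phi> x) = (inverse t)\<^sup>2 * J \<phi>"
      unfolding J_def norm_mult power_mult_distrib norm_of_real power2_abs
      by (intro mean_cmult[OF compact_UNIV] continuous_intros cont[OF \<phi>(1)])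
    ultimately have "t\<^sup>2 * ((inverse t)\<^sup>2 * J \<phi>) \<le> t\<^sup>2 * J \<psi>" by (intro mult_left_mono) auto
    moreover have "t\<^sup>2 * ((inverse t)\<^sup>2 * J \<phi>) = J \<phi>" using t by (simp add: power_inverse)
    ultimately show ?thesis by simp
  qed
  define \<theta> where "\<theta> u x = \<psi> x + (u * \<psi> (x + a) + cnj u * \<psi> (x - a)) / 2" for u x
  have \<theta>: "\<theta> u x = complex_of_real (1 + Re (u * \<psi> a)) * \<psi> x" if u: "cmod u = 1" for u x
  proof -
    define t where "t = 1 + Re (u * \<psi> a)"
    have \<theta>0: "\<theta> v 0 = complex_of_real (1 + Re (v * \<psi> a))" for v
    proof -
      have "\<psi> (0 - a) = cnj (\<psi> a)" using positive_definite_uminus_arg[OF pd[OF \<psi>(1)], of a] by simp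
      then show ?thesis
        using complex_add_cnj[of "v * \<psi> a"] by (simp add: \<theta>_def \<psi>(2))
    qed
    have m: "cmod (- u) = 1" using u by simp
    have P: "\<theta> u \<in> pd_eigenfunctions K s" "\<theta> (- u) \<in> pd_eigenfunctions K s"
      unfolding \<theta>_def by (rule pd_eigenfunctions_modulate[OF \<psi>(1) u], rule pd_eigenfunctions_modulate[OF \<psi>(1) m])
    have t2: "0 \<le> t" "0 \<le> 2 - t"
      using order_trans[OF norm_ge_zero positive_definite_cmod_le[OF pd[OF P(1)], of 0]]
        order_trans[OF norm_ge_zero positive_definite_cmod_le[OF pd[OF P(2)], of 0]]
      by (simp_all add: \<theta>0 t_def)
    have Ju: "J (\<theta> u) \<le> t\<^sup>2 * J \<psi>" by (rule J_le[OF P(1)]) (simp add: \<theta>0 t_def)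
    have Jm: "J (\<theta> (- u)) \<le> (2 - t)\<^sup>2 * J \<psi>" by (rule J_le[OF P(2)]) (simp add: \<theta>0 t_def)
    have sum: "\<theta> (- u) x = 2 * \<psi> x - \<theta> u x" for x by (simp add: \<theta>_def field_simps)
    \<comment> \<open>With \<open>v = \<theta> u x\<close> and \<open>w = \<psi> x\<close>, this identity expresses strict convexity of the squared modulus.\<close>
    have parallelogram: "4 * (cmod (v - of_real t * w))\<^sup>2
        = (2 * (2 - t)) * (cmod v)\<^sup>2 + ((2 * t) * (cmod (2 * w - v))\<^sup>2 - (4 * t * (2 - t)) * (cmod w)\<^sup>2)" for v w
      unfolding cmod_power2 by (simp add: power2_eq_square algebra_simps)
    define D where "D = (\<lambda>x. \<theta> u x - of_real t * \<psi> x)"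
    have cc: "continuous_on UNIV \<psi>" "continuous_on UNIV (\<theta> u)" "continuous_on UNIV (\<theta> (- u))"
      using cont \<psi>(1) P by blast+
    have cD: "continuous_on UNIV D" unfolding D_def by (intro continuous_intros cc)
    have "4 * J D = mean (\<lambda>x. 4 * (cmod (D x))\<^sup>2)"
      unfolding J_def by (intro mean_cmult[OF compact_UNIV, symmetric] continuous_intros cD)
    also have "\<dots> = mean (\<lambda>x. (2 * (2 - t)) * (cmod (\<theta> u x))\<^sup>2 + ((2 * t) * (cmod (\<theta> (- u) x))\<^sup>2
        - (4 * t * (2 - t)) * (cmod (\<psi> x))\<^sup>2))"
      unfolding D_def parallelogram sum ..
    also have "\<dots> = mean (\<lambda>x. (2 * (2 - t)) * (cmod (\<theta> u x))\<^sup>2) + mean (\<lambda>x. (2 * t) * (cmod (\<theta> (- u) x))\<^sup>2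
        - (4 * t * (2 - t)) * (cmod (\<psi> x))\<^sup>2)"
      by (intro mean_add[OF compact_UNIV] continuous_intros cc)
    also have "mean (\<lambda>x. (2 * t) * (cmod (\<theta> (- u) x))\<^sup>2 - (4 * t * (2 - t)) * (cmod (\<psi> x))\<^sup>2)
       = mean (\<lambda>x. (2 * t) * (cmod (\<theta> (- u) x))\<^sup>2) - mean (\<lambda>x. (4 * t * (2 - t)) * (cmod (\<psi> x))\<^sup>2)"
      by (intro mean_diff[OF compact_UNIV] continuous_intros cc)
    also have "mean (\<lambda>x. (2 * (2 - t)) * (cmod (\<theta> u x))\<^sup>2) = (2 * (2 - t)) * J (\<theta> u)"
      unfolding J_def by (intro mean_cmult[OF compact_UNIV] continuous_intros cc)
    also have "mean (\<lambda>x. (2 * t) * (cmod (\<theta> (- u) x))\<^sup>2) = (2 * t) * J (\<theta> (- u))"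
      unfolding J_def by (intro mean_cmult[OF compact_UNIV] continuous_intros cc)
    also have "mean (\<lambda>x. (4 * t * (2 - t)) * (cmod (\<psi> x))\<^sup>2) = (4 * t * (2 - t)) * J \<psi>"
      unfolding J_def by (intro mean_cmult[OF compact_UNIV] continuous_intros cc)
    also have "(2 * (2 - t)) * J (\<theta> u) + ((2 * t) * J (\<theta> (- u)) - (4 * t * (2 - t)) * J \<psi>)
      \<le> (2 * (2 - t)) * (t\<^sup>2 * J \<psi>) + ((2 * t) * ((2 - t)\<^sup>2 * J \<psi>) - (4 * t * (2 - t)) * J \<psi>)"
      using t2 by (intro add_mono diff_mono mult_left_mono Ju Jm) auto
    also have "\<dots> = 0" by (simp add: power2_eq_square algebra_simps)
    finally have JD: "J D \<le> 0" by simp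
    have "D x = 0"
    proof (rule ccontr)
      assume "D x \<noteq> 0"
      then have "0 < J D"
        unfolding J_def by (intro mean_square_pos[OF compact_UNIV, of _ x] continuous_intros cD) simp
      with JD show False by simp
    qed
    then show ?thesis by (simp add: D_def t_def)
  qed
  have key: "u * \<psi> (x + a) + cnj u * \<psi> (x - a) = 2 * (complex_of_real (Re (u * \<psi> a)) * \<psi> x)"
    if u: "cmod u = 1" for u
  proof -
    have "(u * \<psi> (x + a) + cnj u * \<psi> (x - a)) / 2 = complex_of_real (Re (u * \<psi> a)) * \<psi> x"
      using \<theta>[OF u, of x] unfolding \<theta>_def of_real_add of_real_1 distrib_right by simp
    then show ?thesis by (simp only: divide_eq_eq) simp
  qed
  have "\<psi> (x + a) + \<psi> (x - a) = 2 * (of_real (Re (\<psi> a)) * \<psi> x)"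
    using key[of 1] by simp
  moreover have "\<i> * (\<i> * \<psi> (x + a) + cnj \<i> * \<psi> (x - a)) = \<i> * (2 * (complex_of_real (Re (\<i> * \<psi> a)) * \<psi> x))"
    using key[of \<i>] by simp
  then have "\<psi> (x + a) - \<psi> (x - a) = 2 * \<i> * of_real (Im (\<psi> a)) * \<psi> x"
    by (simp add: algebra_simps)
  ultimately have "2 * \<psi> (x + a) = 2 * (of_real (Re (\<psi> a)) + \<i> * of_real (Im (\<psi> a))) * \<psi> x"
    by (simp add: algebra_simps)
  then show ?thesis by (simp flip: complex_eq)
qed

end

section \<open>Characters separate points\<close>

lemma compact_t2_continuous_separation:
  fixes a b :: "'a::t2_space"
  assumes "compact (UNIV :: 'a set)" "a \<noteq> b"
  obtains f :: "'a \<Rightarrow> real" where "continuous_on UNIV f" "f a \<noteq> f b"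
proof -
  have "compact_space (euclidean :: 'a topology)"
    using assms(1) by (simp add: compact_space_def)
  moreover have "Hausdorff_space (euclidean :: 'a topology)"
    unfolding Hausdorff_space_def
  proof (intro allI impI)
    fix x y :: 'a assume "x \<in> topspace euclidean \<and> y \<in> topspace euclidean \<and> x \<noteq> y"
    then obtain U V where "open U" "open V" "x \<in> U" "y \<in> V" "U \<inter> V = {}"
      using hausdorff[of x y] by blast
    then show "\<exists>U V. openin euclidean U \<and> openin euclidean V \<and> x \<in> U \<and> y \<in> V \<and> disjnt U V"
      by (auto simp: open_openin[symmetric] disjnt_def)
  qed
  ultimately have "normal_space (euclidean :: 'a topology)"
    using compact_Hausdorff_or_regular_imp_normal_space by blast
  moreover have "closedin euclidean {a}" "closedin euclidean {b}" by (simp_all flip: closed_closedin)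
  moreover have "disjnt {a} {b}" using assms(2) by (simp add: disjnt_def)
  ultimately obtain f where "continuous_map euclidean euclideanreal f" "f ` {a} \<subseteq> {0}" "f ` {b} \<subseteq> {1}"
    by (rule Urysohn_lemma_alt)
  then show ?thesis by (intro that[of f]) auto
qed

context
  assumes compact_UNIV: "compact (UNIV :: 'g::{topological_ab_group_add, t2_space} set)"
begin

text \<open>
  Let the continuous function \<open>f\<^sub>0\<close> separate \<open>a\<close> from 0, and let the kernel \<open>K\<close> be the autocorrelation of
  \<open>d x = f\<^sub>0 (x + a) - f\<^sub>0 x\<close>. Convolution with \<open>K\<close> annihilates every function of period \<open>a\<close>, but it is
  not the zero operator. So a character whose real part is an eigenfunction of its square to a positive
  eigenvalue cannot have \<open>a\<close> in its kernel; the maximiser of the previous section is such a character.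
\<close>

lemma characters_separate_points:
  fixes a :: 'g
  assumes a: "a \<noteq> 0"
  obtains \<xi> :: "'g \<Rightarrow> complex" where "character \<xi>" "\<xi> a \<noteq> 1"
proof -
  note comp = compact_UNIV
  obtain f\<^sub>0 :: "'g \<Rightarrow> real" where f0: "continuous_on UNIV f\<^sub>0" "f\<^sub>0 a \<noteq> f\<^sub>0 0"
    by (rule compact_t2_continuous_separation[OF comp a]) (rule that)
  define d where "d x = f\<^sub>0 (x + a) - f\<^sub>0 x" for x
  have f0a: "continuous_on UNIV (\<lambda>x. f\<^sub>0 (x + a))"
    by (intro continuous_intros continuous_on_compose_UNIV[OF f0(1)])
  have d: "continuous_on UNIV d" unfolding d_def by (intro continuous_intros f0a f0(1))
  define K where "K = correlate d d"
  have K: "continuous_on UNIV K" unfolding K_def by (rule continuous_on_correlate[OF comp d d])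
  have "K 0 = mean (\<lambda>y. (d y)\<^sup>2)" by (simp add: K_def correlate_def power2_eq_square)
  moreover have "d 0 \<noteq> 0" using f0(2) by (simp add: d_def)
  ultimately have K0: "K 0 \<noteq> 0" using mean_square_pos[OF comp d] by force
  have even: "K (- x) = K x" for x
    using correlate_diff_arg[OF comp d d, of 0 x] by (simp add: K_def correlate_def mult.commute)
  \<comment> \<open>\<open>K\<close> is the difference between a translate of \<open>L\<close> and \<open>L\<close>, so convolution with it annihilates functions of period \<open>a\<close>.\<close>
  define L where "L = correlate f\<^sub>0 d"
  have L: "continuous_on UNIV L" unfolding L_def by (rule continuous_on_correlate[OF comp f0(1) d])
  have KL: "K x = L (x + a) - L x" for x
  proof -
    have "d (x + y) * d y = f\<^sub>0 ((x + a) + y) * d y - f\<^sub>0 (x + y) * d y" for y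
      using d_def[of "x + y"] by (simp add: left_diff_distrib add_ac)
    then have "K x = mean (\<lambda>y. f\<^sub>0 ((x + a) + y) * d y - f\<^sub>0 (x + y) * d y)"
      unfolding K_def correlate_def by simp
    also have "\<dots> = L (x + a) - L x"
      unfolding L_def correlate_def
      by (intro mean_diff[OF comp] continuous_on_correlate_integrand(2)[OF comp f0(1) d])
    finally show ?thesis .
  qed
  have vanish: "convolve K h x = 0" if h: "continuous_on UNIV h" and per: "\<And>y. h (y + a) = h y" for h x
  proof -
    note int = continuous_on_convolve_integrand(2)[OF comp L h]
    have "convolve K h x = mean (\<lambda>y. L ((x + a) - y) * h y - L (x - y) * h y)"
      unfolding convolve_def KL by (simp add: algebra_simps)
    also have "\<dots> = convolve L h (x + a) - convolve L h x"
      unfolding convolve_def by (intro mean_diff[OF comp] int)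
    also have "convolve L h (x + a) = convolve L h x"
      using convolve_shift[OF comp L h, of a x] per by simp
    finally show ?thesis by simp
  qed
  obtain s f x0 where s: "s > 0" and f: "continuous_on UNIV f" "f x0 \<noteq> 0"
    and eig: "\<And>x. convolve K (convolve K f) x = s * f x"
    by (rule convolve_square_eigenfunction_exists[OF comp K even K0]) (rule that)
  \<comment> \<open>The normalised autocorrelation of \<open>f\<close> is a positive-definite eigenfunction to start from.\<close>
  have q: "correlate f f 0 > 0"
    using mean_square_pos[OF comp f] by (simp add: correlate_def power2_eq_square)
  define \<psi>\<^sub>0 where "\<psi>\<^sub>0 x = complex_of_real (inverse (correlate f f 0)) * complex_of_real (correlate f f x)" for x
  have cf: "continuous_on UNIV (correlate f f)" by (rule continuous_on_correlate[OF comp f(1) f(1)])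
  have cKf: "continuous_on UNIV (convolve K f)" by (rule continuous_on_convolve[OF comp K f(1)])
  have "convolve K (correlate f f) = correlate (convolve K f) f"
    using convolve_correlate[OF comp K f(1) f(1)] by blast
  then have "convolve K (convolve K (correlate f f)) x = s * correlate f f x" for x
    using convolve_correlate[OF comp K cKf f(1), of x]
      mean_cmult[OF comp continuous_on_correlate_integrand(2)[OF comp f(1) f(1)], of s x]
    by (simp add: correlate_def eig mult.assoc)
  with cf have V: "correlate f f \<in> square_eigenspace K s" by (simp add: square_eigenspace_def)
  have "(\<lambda>x. 0) \<in> square_eigenspace K s" using square_eigenspace_linear[OF comp K s V V, of 0 0] by simp
  then have "(\<lambda>x. complex_of_real (correlate f f x)) \<in> pd_eigenfunctions K s"
    using V positive_definite_autocorrelation[OF comp f(1)] by (simp add: pd_eigenfunctions_def)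
  then have "\<psi>\<^sub>0 \<in> pd_eigenfunctions K s"
    unfolding \<psi>\<^sub>0_def by (rule pd_eigenfunctions_scale[OF comp K s]) (use q in simp)
  moreover have "\<psi>\<^sub>0 0 = 1" using q by (simp add: \<psi>\<^sub>0_def)
  ultimately obtain \<psi> where \<psi>: "\<psi> \<in> pd_eigenfunctions K s" "\<psi> 0 = 1"
    and max: "\<And>\<phi>. \<phi> \<in> pd_eigenfunctions K s \<Longrightarrow> \<phi> 0 = 1 \<Longrightarrow>
      mean (\<lambda>x. (cmod (\<phi> x))\<^sup>2) \<le> mean (\<lambda>x. (cmod (\<psi> x))\<^sup>2)"
    by (rule pd_eigenfunctions_maximiser[OF comp K s]) (rule that)
  have mult: "\<psi> (x + y) = \<psi> y * \<psi> x" for x y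
    by (rule pd_eigenfunctions_maximiser_multiplicative[OF comp K s \<psi> max])
  have norm: "cmod (\<psi> x) = 1" for x
  proof -
    have "positive_definite \<psi>" using \<psi>(1) by (simp add: pd_eigenfunctions_def)
    then have "\<psi> x * cnj (\<psi> x) = 1"
      using mult[of "- x" x] \<psi>(2) by (simp add: positive_definite_uminus_arg)
    then have "complex_of_real ((cmod (\<psi> x))\<^sup>2) = 1" using complex_norm_square[of "\<psi> x"] by simp
    then have "(cmod (\<psi> x))\<^sup>2 = 1" by (simp only: of_real_eq_1_iff)
    then show ?thesis using norm_ge_zero[of "\<psi> x"] by (simp add: power2_eq_1_iff)
  qed
  have "character \<psi>"
    unfolding character_def
    using pd_eigenfunctions_continuous[OF \<psi>(1)] norm mult by (auto simp: mult.commute)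
  moreover have "\<psi> a \<noteq> 1"
  proof
    assume one: "\<psi> a = 1"
    let ?R = "\<lambda>x. Re (\<psi> x)"
    have R: "?R \<in> square_eigenspace K s" using \<psi>(1) by (simp add: pd_eigenfunctions_def)
    then have cR: "continuous_on UNIV ?R" by (simp add: square_eigenspace_def)
    have "convolve K ?R = (\<lambda>x. 0)"
      by (rule ext, rule vanish[OF cR]) (simp add: mult one)
    moreover have "convolve K (\<lambda>x. 0) 0 = 0" by (rule vanish) auto
    ultimately have "s * ?R 0 = 0" using R by (simp add: square_eigenspace_def)
    then show False using s \<psi>(2) by simp
  qed
  ultimately show ?thesis by (rule that)
qed

end


section \<open>Linearly ordered groups with finite initial segments\<close>

text \<open>
  An element \<open>\<eta>\<close> of the cone is a quotient of two elements with an index, and then the set of elements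
  of the cone that are not above \<open>\<eta>\<close> is finite as well. By linearity this set consists of the elements
  of the cone that are smaller than \<open>\<eta>\<close>. So a nontrivial cone has a least element \<open>\<xi>\<close> above the unit, and repeated division
  by \<open>\<xi>\<close> reaches the unit after finitely many steps.
\<close>

lemma (in comm_group) positive_cone_cyclic:
  assumes cone: "positive_cone T G" and linear: "linearly_ordered_by G T"
    and index: "carrier G = elements_with_index G T"
  obtains \<xi> where "\<xi> \<in> T" "\<And>\<tau>. \<tau> \<in> T \<Longrightarrow> \<exists>n::nat. \<tau> = \<xi> [^] n"
proof -
  have sub: "submonoid T G" using cone by (simp add: positive_cone_def)
  have TG: "\<tau> \<in> carrier G" if "\<tau> \<in> T" for \<tau> using submonoid.mem_carrier[OF sub that] .
  have one: "\<one> \<in> T" using submonoid.one_closed[OF sub] .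
  have mult: "\<sigma> \<otimes> \<tau> \<in> T" if "\<sigma> \<in> T" "\<tau> \<in> T" for \<sigma> \<tau> using submonoid.m_closed[OF sub that] .
  have antisym: "\<tau> = \<one>" if "\<tau> \<in> T" "inv \<tau> \<in> T" for \<tau>
  proof -
    have "\<tau> = inv (inv \<tau>)" using TG[OF that(1)] by simp
    then have "\<tau> \<in> set_inv T" using that(2) by (auto simp: SET_INV_def)
    then show ?thesis using cone that(1) by (auto simp: positive_cone_def)
  qed
  have total: "inv \<sigma> \<otimes> \<tau> \<in> T \<or> inv \<tau> \<otimes> \<sigma> \<in> T" if "\<sigma> \<in> T" "\<tau> \<in> T" for \<sigma> \<tau>
  proof -
    have c: "\<sigma> \<in> carrier G" "\<tau> \<in> carrier G" using that TG by auto
    then have "inv \<sigma> \<otimes> \<tau> \<in> T \<union> set_inv T" using linear by (simp add: linearly_ordered_by_def)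
    then consider "inv \<sigma> \<otimes> \<tau> \<in> T" | \<rho> where "\<rho> \<in> T" "inv \<sigma> \<otimes> \<tau> = inv \<rho>"
      by (auto simp: SET_INV_def)
    then show ?thesis
    proof cases
      case 2
      have "inv \<tau> \<otimes> \<sigma> = inv (inv \<sigma> \<otimes> \<tau>)" using c by (simp add: inv_mult_group)
      then have "inv \<tau> \<otimes> \<sigma> = \<rho>" using 2 TG by simp
      then show ?thesis using 2 by simp
    qed simp
  qed
  \<comment> \<open>\<open>I \<eta>\<close> is the initial segment of the cone below \<open>\<eta>\<close>.\<close>
  define I where "I \<eta> = T - (\<eta> <# T)" for \<eta>
  have I_iff: "\<tau> \<in> I \<sigma> \<longleftrightarrow> \<tau> \<in> T \<and> inv \<sigma> \<otimes> \<tau> \<notin> T" if "\<sigma> \<in> T" for \<sigma> \<tau>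
  proof -
    have "\<tau> \<in> \<sigma> <# T \<longleftrightarrow> inv \<sigma> \<otimes> \<tau> \<in> T" if "\<tau> \<in> T"
    proof
      assume "\<tau> \<in> \<sigma> <# T"
      then obtain \<rho> where \<rho>: "\<rho> \<in> T" "\<tau> = \<sigma> \<otimes> \<rho>" by (auto simp: l_coset_def)
      then have "inv \<sigma> \<otimes> \<tau> = \<rho>" using TG \<open>\<sigma> \<in> T\<close> by (simp add: m_assoc[symmetric])
      then show "inv \<sigma> \<otimes> \<tau> \<in> T" using \<rho> by simp
    next
      assume "inv \<sigma> \<otimes> \<tau> \<in> T"
      moreover have "\<tau> = \<sigma> \<otimes> (inv \<sigma> \<otimes> \<tau>)" using TG \<open>\<sigma> \<in> T\<close> that by (simp add: m_assoc[symmetric])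
      ultimately show "\<tau> \<in> \<sigma> <# T" unfolding l_coset_def by blast
    qed
    then show ?thesis by (auto simp: I_def)
  qed
  have fin: "finite (I \<eta>)" if \<eta>: "\<eta> \<in> T" for \<eta>
  proof -
    have "\<eta> \<in> elements_with_index G T" using TG[OF \<eta>] index by blast
    then obtain \<eta>1 \<eta>2 where *: "\<eta>1 \<in> T" "\<eta>2 \<in> T" "\<eta> = \<eta>1 \<otimes> inv \<eta>2" "finite (T - (\<eta>1 <# T))"
      by (auto simp: elements_with_index_def)
    then have "\<eta>1 = \<eta> \<otimes> \<eta>2" using TG by (simp add: m_assoc)
    then have "\<eta>1 <# T \<subseteq> \<eta> <# T"
      using mult *(2) TG \<eta> by (auto simp: l_coset_def m_assoc)
    then have "I \<eta> \<subseteq> T - (\<eta>1 <# T)" by (auto simp: I_def)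
    then show ?thesis using *(4) finite_subset by blast
  qed
  have smaller: "card (I \<tau>) < card (I \<sigma>)"
    if \<sigma>: "\<sigma> \<in> T" and \<tau>: "\<tau> \<in> T" and le: "inv \<tau> \<otimes> \<sigma> \<in> T" and ne: "\<tau> \<noteq> \<sigma>" for \<sigma> \<tau>
  proof (rule psubset_card_mono[OF fin[OF \<sigma>]])
    have c: "\<sigma> \<in> carrier G" "\<tau> \<in> carrier G" using \<sigma> \<tau> TG by auto
    have "inv \<tau> \<otimes> \<rho> \<in> T" if "inv \<sigma> \<otimes> \<rho> \<in> T" "\<rho> \<in> T" for \<rho>
    proof -
      have \<rho>: "\<rho> \<in> carrier G" using TG[OF that(2)] .
      have "\<sigma> \<otimes> (inv \<sigma> \<otimes> \<rho>) = \<rho>" using c \<rho> by (simp flip: m_assoc)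
      then have "inv \<tau> \<otimes> \<rho> = (inv \<tau> \<otimes> \<sigma>) \<otimes> (inv \<sigma> \<otimes> \<rho>)"
        using c \<rho> by (simp add: m_assoc)
      then show ?thesis using mult[OF le that(1)] by simp
    qed
    then have "I \<tau> \<subseteq> I \<sigma>" using I_iff[OF \<sigma>] I_iff[OF \<tau>] by blast
    moreover have "\<tau> \<notin> I \<tau>" using I_iff[OF \<tau>] c one by simp
    moreover have "\<tau> \<in> I \<sigma>"
    proof (rule ccontr)
      assume "\<tau> \<notin> I \<sigma>"
      then have "inv \<sigma> \<otimes> \<tau> \<in> T" using I_iff[OF \<sigma>] \<tau> by blast
      moreover have "inv \<sigma> \<otimes> \<tau> = inv (inv \<tau> \<otimes> \<sigma>)" using c by (simp add: inv_mult_group)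
      ultimately have "inv \<tau> \<otimes> \<sigma> = \<one>" using antisym[OF le] by simp
      then show False using c ne by (metis inv_closed inv_equality inv_inv)
    qed
    ultimately show "I \<tau> \<subset> I \<sigma>" by blast
  qed
  show ?thesis
  proof (cases "T = {\<one>}")
    case True
    then show ?thesis by (intro that[of \<one>]) (auto intro: exI[of _ "0::nat"])
  next
    case False
    then obtain \<sigma> where "\<sigma> \<in> T" "\<sigma> \<noteq> \<one>" using one by blast
    then obtain \<xi> where \<xi>: "\<xi> \<in> T" "\<xi> \<noteq> \<one>"
      and least: "\<And>\<tau>. \<tau> \<in> T \<Longrightarrow> \<tau> \<noteq> \<one> \<Longrightarrow> card (I \<xi>) \<le> card (I \<tau>)"
      using ex_has_least_nat[of "\<lambda>\<tau>. \<tau> \<in> T \<and> \<tau> \<noteq> \<one>" \<sigma> "\<lambda>\<tau>. card (I \<tau>)"] by blast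
    have "\<exists>n::nat. \<tau> = \<xi> [^] n" if "\<tau> \<in> T" for \<tau>
      using that
    proof (induction "card (I \<tau>)" arbitrary: \<tau> rule: less_induct)
      case less
      show ?case
      proof (cases "\<tau> = \<one>")
        case True
        then show ?thesis by (intro exI[of _ 0]) simp
      next
        case False
        have c: "\<xi> \<in> carrier G" "\<tau> \<in> carrier G" using \<xi>(1) less.prems TG by auto
        define \<rho> where "\<rho> = inv \<xi> \<otimes> \<tau>"
        have \<rho>: "\<rho> \<in> T"
        proof (rule ccontr)
          assume "\<rho> \<notin> T"
          then have "inv \<tau> \<otimes> \<xi> \<in> T" "\<tau> \<noteq> \<xi>"
            using total[OF \<xi>(1) less.prems] one c by (auto simp: \<rho>_def)
          then have "card (I \<tau>) < card (I \<xi>)" using smaller[OF \<xi>(1) less.prems] by blast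
          then show False using least[OF less.prems False] by simp
        qed
        have "\<rho> \<otimes> \<xi> = \<xi> \<otimes> \<rho>" using TG[OF \<rho>] c(1) by (rule m_comm)
        then have \<tau>: "\<tau> = \<rho> \<otimes> \<xi>" using c by (simp add: \<rho>_def flip: m_assoc)
        have "inv \<rho> \<otimes> (\<rho> \<otimes> \<xi>) = \<xi>"
          using inv_closed[OF TG[OF \<rho>]] TG[OF \<rho>] c(1) by (subst m_assoc[symmetric]) auto
        then have "inv \<rho> \<otimes> \<tau> = \<xi>" unfolding \<tau> .
        moreover have "\<rho> \<noteq> \<tau>"
        proof
          assume "\<rho> = \<tau>"
          then have "\<rho> \<otimes> \<xi> = \<rho>" using \<tau> by metis
          then show False using l_cancel_one[OF TG[OF \<rho>] c(1)] \<xi>(2) by blast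
        qed
        ultimately have "card (I \<rho>) < card (I \<tau>)" using smaller[OF less.prems \<rho>] \<xi>(1) by simp
        then obtain n :: nat where "\<rho> = \<xi> [^] n" using less.hyps \<rho> by blast
        then have "\<tau> = \<xi> [^] Suc n" using \<tau> by simp
        then show ?thesis ..
      qed
    qed
    with \<xi>(1) that show ?thesis by blast
  qed
qed


section \<open>Characters of connected groups\<close>

text \<open>
  The real part takes every value between 1 and \<open>Re (\<xi> x0)\<close>, and the range is closed under conjugation.
  So it contains a whole arc that starts at 1, and the powers of the points of this arc fill the circle.
\<close>

lemma range_connected_character:
  fixes \<xi> :: "'g::topological_ab_group_add \<Rightarrow> complex"
  assumes conn: "connected (UNIV :: 'g set)" and \<xi>: "character \<xi>" and x0: "\<xi> x0 \<noteq> 1"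
  shows "range \<xi> = sphere 0 1"
proof
  show "range \<xi> \<subseteq> sphere 0 1" using \<xi> by (simp add: character_def)
  have norm: "cmod (\<xi> x) = 1" for x using \<xi> by (auto simp: character_def image_subset_iff)
  have add: "\<xi> (x + y) = \<xi> x * \<xi> y" for x y using \<xi> by (simp add: character_def)
  have nz: "\<xi> x \<noteq> 0" for x using norm[of x] by auto
  have zero: "\<xi> 0 = 1" using add[of 0 0] nz[of 0] by simp
  have uminus: "\<xi> (- x) = inverse (\<xi> x)" for x
    using add[of "- x" x] zero nz[of x] by (simp add: field_simps)
  have power: "\<exists>y. \<xi> y = \<xi> x ^ n" for x and n :: nat
  proof (induction n)
    case 0
    then show ?case using zero by auto
  next
    case (Suc n)
    then obtain y where "\<xi> y = \<xi> x ^ n" ..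
    then have "\<xi> (x + y) = \<xi> x ^ Suc n" by (simp add: add)
    then show ?case ..
  qed
  have circle: "(Re z)\<^sup>2 + (Im z)\<^sup>2 = 1" if "cmod z = 1" for z using that by (simp add: cmod_def)
  define r where "r = Re (\<xi> x0)"
  have r: "- 1 \<le> r" "r < 1"
  proof -
    have "\<bar>r\<bar> \<le> 1" using abs_Re_le_cmod[of "\<xi> x0"] norm by (simp add: r_def)
    moreover have "r \<noteq> 1"
    proof
      assume "r = 1"
      then have "\<xi> x0 = 1" using circle[OF norm[of x0]] by (simp add: r_def complex_eq_iff)
      with x0 show False ..
    qed
    ultimately show "- 1 \<le> r" "r < 1" by auto
  qed
  define \<alpha> where "\<alpha> = arccos r"
  have \<alpha>: "0 < \<alpha>" "\<alpha> \<le> pi" "cos \<alpha> = r"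
    using r arccos_lt_bounded[of r] arccos_lbound[of r] arccos_ubound[of r] cos_arccos[of r]
      arccos_eq_0_iff[of r] unfolding \<alpha>_def by (auto simp: less_le)
  have small: "cis t \<in> range \<xi>" if t: "0 \<le> t" "t \<le> \<alpha>" for t
  proof -
    have "continuous_on UNIV (\<lambda>x. Re (\<xi> x))"
      using \<xi> by (intro continuous_intros) (simp add: character_def)
    then have "connected (range (\<lambda>x. Re (\<xi> x)))" using conn by (rule connected_continuous_image)
    moreover have "r \<in> range (\<lambda>x. Re (\<xi> x))" by (simp add: r_def)
    moreover have "1 \<in> range (\<lambda>x. Re (\<xi> x))" using zero by (intro image_eqI[of _ _ 0]) auto
    ultimately have "{r..1} \<subseteq> range (\<lambda>x. Re (\<xi> x))" by (rule connected_contains_Icc)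
    moreover have "r \<le> cos t" using t \<alpha> cos_monotone_0_pi_le[of t \<alpha>] by simp
    ultimately obtain x where x: "Re (\<xi> x) = cos t" by (metis atLeastAtMost_iff cos_le_one rangeE subsetD)
    have "(Im (\<xi> x))\<^sup>2 = (sin t)\<^sup>2" using circle[OF norm[of x]] x sin_squared_eq[of t] by simp
    then consider "Im (\<xi> x) = sin t" | "Im (\<xi> x) = - sin t" by (auto simp: power2_eq_iff)
    then show ?thesis
    proof cases
      case 1
      then have "\<xi> x = cis t" using x by (simp add: complex_eq_iff)
      then show ?thesis by (metis rangeI)
    next
      case 2
      then have "\<xi> x = cis (- t)" using x by (simp add: complex_eq_iff)
      then have "\<xi> (- x) = cis t" by (simp add: uminus)
      then show ?thesis by (metis rangeI)
    qed
  qed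
  show "sphere 0 1 \<subseteq> range \<xi>"
  proof
    fix w :: complex assume "w \<in> sphere 0 1"
    then have w: "cmod w = 1" by simp
    define t where "t = Arg2pi w"
    have t: "0 \<le> t" "w = cis t"
      using Arg2pi[of w] w by (auto simp: t_def cis_conv_exp is_Arg_def)
    obtain n :: nat where n: "t < real n * \<alpha>" using reals_Archimedean3[OF \<alpha>(1)] by blast
    then have n0: "n > 0" using t(1) by (cases n) auto
    have "t / n \<le> \<alpha>" using n n0 by (simp add: field_simps)
    then have "cis (t / n) \<in> range \<xi>" using t(1) by (intro small) auto
    then obtain x where x: "cis (t / n) = \<xi> x" by blast
    obtain y where "\<xi> y = \<xi> x ^ n" using power by blast
    also have "\<dots> = cis (real n * (t / n))" unfolding x[symmetric] by (rule Complex.DeMoivre)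
    also have "\<dots> = w" using n0 t(2) by simp
    finally show "w \<in> range \<xi>" by (metis rangeI)
  qed
qed


section \<open>Groups with cyclic character group\<close>

lemma character_group_nat_pow: "(\<xi> [^]\<^bsub>character_group\<^esub> (n::nat)) x = \<xi> x ^ n"
  by (induction n) (simp_all add: character_group_def mult.commute)

theorem corollary1:
  fixes T :: "('g::{topological_ab_group_add, t2_space} \<Rightarrow> complex) set"
  assumes "compact (UNIV :: 'g set)"
    and "connected (UNIV :: 'g set)"
    and "(UNIV :: 'g set) \<noteq> {0}"
    and "positive_cone T character_group"
    and "linearly_ordered_by character_group T"
    and "carrier character_group = elements_with_index character_group T"
  shows "\<exists>(f :: 'g \<Rightarrow> complex) g.
           homeomorphism UNIV (sphere 0 1) f g \<and> (\<forall>x y. f (x + y) = f x * f y)"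
proof -
  interpret X: comm_group "character_group :: ('g \<Rightarrow> complex) monoid"
    by (rule comm_group_character_group)
  obtain \<xi> where \<xi>: "\<xi> \<in> T" and gen: "\<And>\<tau>. \<tau> \<in> T \<Longrightarrow> \<exists>n::nat. \<tau> = \<xi> [^]\<^bsub>character_group\<^esub> n"
    by (rule X.positive_cone_cyclic[OF assms(4-6)]) (rule that)
  have "T \<subseteq> carrier character_group"
    using assms(4) unfolding positive_cone_def by (blast dest: submonoid.subset)
  with \<xi> have char: "character \<xi>" by (auto simp: character_group_def)
  have add: "\<xi> (x + y) = \<xi> x * \<xi> y" for x y using char by (simp add: character_def)
  have kernel: "x = 0" if x: "\<xi> x = 1" for x
  proof (rule ccontr)
    assume "x \<noteq> 0"
    then obtain \<psi> where \<psi>: "character \<psi>" "\<psi> x \<noteq> 1"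
      by (rule characters_separate_points[OF assms(1)]) (rule that)
    have T1: "\<tau> x = 1" if "\<tau> \<in> T" for \<tau>
      using gen[OF that] x by (auto simp: character_group_nat_pow)
    have \<psi>c: "\<psi> \<in> carrier character_group" using \<psi>(1) by (simp add: character_group_def)
    then have "\<psi> \<in> T \<union> set_inv\<^bsub>character_group\<^esub> T"
      using assms(5) by (simp add: linearly_ordered_by_def)
    then consider "\<psi> \<in> T" | \<tau> where "\<tau> \<in> T" "\<psi> = inv\<^bsub>character_group\<^esub> \<tau>"
      by (auto simp: SET_INV_def)
    then show False
    proof cases
      case 1
      then show False using T1 \<psi>(2) by blast
    next
      case 2
      then have "\<tau> \<in> carrier character_group" using \<open>T \<subseteq> carrier character_group\<close> by blast
      then have "\<psi> \<otimes>\<^bsub>character_group\<^esub> \<tau> = \<one>\<^bsub>character_group\<^esub>" using 2 by simp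
      then have "\<psi> x * \<tau> x = 1" by (simp add: character_group_def fun_eq_iff)
      then show False using T1[OF 2(1)] \<psi>(2) by simp
    qed
  qed
  have inj: "inj \<xi>"
  proof (rule injI)
    fix x y assume eq: "\<xi> x = \<xi> y"
    have "\<xi> x \<noteq> 0"
      using char by (auto simp: character_def image_subset_iff dest!: spec[of _ x])
    moreover have "\<xi> x = \<xi> (x - y) * \<xi> y" using add[of "x - y" y] by simp
    ultimately have "\<xi> (x - y) = 1" using eq by simp
    then show "x = y" using kernel[of "x - y"] by simp
  qed
  obtain x0 :: 'g where "x0 \<noteq> 0" using assms(3) by blast
  then have "\<xi> x0 \<noteq> 1" using kernel by blast
  then have range: "range \<xi> = sphere 0 1" by (rule range_connected_character[OF assms(2) char])
  have "continuous_on UNIV \<xi>" using char by (simp add: character_def)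
  from homeomorphism_compact[OF assms(1) this range inj] add show ?thesis by blast
qed


end
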